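(* Let $2\le p<\infty$. There is a constant $c>0$ such that for all $d\ge 2$ and $\varepsilon\in(0,1/2)$, \[ n(\varepsilon,F_d^{\log},L_p)\,\le\, c\,d\,\varepsilon^{-3p/2}\log^3(\varepsilon^{-p}). \]
   Context: For $f\in C([0,1]^d)$ (continuous, complex-valued) and $k\in\mathbb{Z}^d$, let $\hat f(k)=\int_{[0,1]^d} f(x)e^{-2\pi i\langle k,x\rangle}\,dx$. Define the function class \[ F_d^{\log}:=\Big\{f\in C([0,1]^d)\ \Big|\ \sum_{k\in\mathbb{Z}^d}|\hat f(k)|\max(1,\log\|k\|_\infty)\le 1\Big\}, \] where the factor $\max(1,\log\|k\|_\infty)$ equals $1$ for $k=0$. For a class $F_d$ of functions on $[0,1]^d$, the (information) complexity $n(\varepsilon,F_d,L_p)$ is the minimal $n\in\mathbb{N}$ for which there are sampling points $x_1,\dots,x_n\in[0,1]^d$ and a (possibly non-linear) recovery map $\phi\colon\mathbb{C}^n\to L_p([0,1]^d)$ such that $A_n(f)=\phi(f(x_1),\dots,f(x_n))$ satisfies $\sup_{f\in F_d}\|f-A_n(f)\|_p\le\varepsilon$, where $\|\cdot\|_p$ is the norm of $L_p([0,1]^d)$ with Lebesgue measure. *)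

theory Defs
  imports "HOL-Analysis.Analysis"
begin

text \<open>The dimension \<open>d\<close> must range over the naturals inside the statement, since the
  constant is uniform in \<open>d\<close>. Points of \<open>[0,1]^d\<close> are therefore extensional functions on
  \<open>{..<d}\<close>; the ambient product topology on \<open>nat \<Rightarrow> real\<close> induces the Euclidean topology there.\<close>

definition cube :: "nat \<Rightarrow> (nat \<Rightarrow> real) set" where
  "cube d = {..<d} \<rightarrow>\<^sub>E {0..1}"

definition cube_measure :: "nat \<Rightarrow> (nat \<Rightarrow> real) measure" where
  "cube_measure d = Pi\<^sub>M {..<d} (\<lambda>_. restrict_space lborel {0..1})"

lemma space_cube_measure: "space (cube_measure d) = cube d"
  by (simp add: cube_measure_def cube_def space_PiM space_restrict_space)

definition freqs :: "nat \<Rightarrow> (nat \<Rightarrow> int) set" where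
  "freqs d = {..<d} \<rightarrow>\<^sub>E UNIV"

definition fourier_coeff :: "nat \<Rightarrow> ((nat \<Rightarrow> real) \<Rightarrow> complex) \<Rightarrow> (nat \<Rightarrow> int) \<Rightarrow> complex" where
  "fourier_coeff d f k =
     (LINT x|cube_measure d.
        f x * exp (- 2 * of_real pi * \<i> * of_real (\<Sum>i<d. of_int (k i) * x i)))"

text \<open>Only meaningful for \<open>d \<ge> 1\<close>.\<close>

definition sup_norm :: "nat \<Rightarrow> (nat \<Rightarrow> int) \<Rightarrow> int" where
  "sup_norm d k = Max ((\<lambda>i. \<bar>k i\<bar>) ` {..<d})"

definition log_weight :: "nat \<Rightarrow> (nat \<Rightarrow> int) \<Rightarrow> real" where
  "log_weight d k =
     (if sup_norm d k = 0 then 1 else max 1 (ln (real_of_int (sup_norm d k))))"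

text \<open>Summability is required separately because \<open>infsum\<close> of a divergent family is \<open>0\<close>.
  Values of \<open>f\<close> outside the cube are unconstrained and never used.\<close>

definition F_log :: "nat \<Rightarrow> ((nat \<Rightarrow> real) \<Rightarrow> complex) set" where
  "F_log d = {f. continuous_on (cube d) f \<and>
     (\<lambda>k. norm (fourier_coeff d f k) * log_weight d k) summable_on freqs d \<and>
     (\<Sum>\<^sub>\<infinity>k\<in>freqs d. norm (fourier_coeff d f k) * log_weight d k) \<le> 1}"

text \<open>Elements of \<open>L\<^sub>p\<close> are represented by functions rather than by classes modulo null sets.\<close>

definition Lp_space :: "real \<Rightarrow> nat \<Rightarrow> ((nat \<Rightarrow> real) \<Rightarrow> complex) set" where
  "Lp_space p d = {g. g \<in> borel_measurable (cube_measure d) \<and>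
     integrable (cube_measure d) (\<lambda>x. norm (g x) powr p)}"

definition Lp_norm :: "real \<Rightarrow> nat \<Rightarrow> ((nat \<Rightarrow> real) \<Rightarrow> complex) \<Rightarrow> real" where
  "Lp_norm p d g = (LINT x|cube_measure d. norm (g x) powr p) powr (1 / p)"

text \<open>\<open>n\<close> samples at \<open>x\<close>, followed by a recovery map \<open>\<phi>\<close> on \<open>\<complex>\<^sup>n\<close>, achieve worst-case error at most
  \<open>\<epsilon>\<close> on the class \<open>F\<close>.\<close>

definition recoverable ::
  "real \<Rightarrow> ((nat \<Rightarrow> real) \<Rightarrow> complex) set \<Rightarrow> real \<Rightarrow> nat \<Rightarrow> nat \<Rightarrow> bool" where
  "recoverable \<epsilon> F p d n \<longleftrightarrow>
     (\<exists>(x :: nat \<Rightarrow> nat \<Rightarrow> real) (\<phi> :: (nat \<Rightarrow> complex) \<Rightarrow> (nat \<Rightarrow> real) \<Rightarrow> complex).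
        (\<forall>i<n. x i \<in> cube d) \<and>
        \<phi> \<in> ({..<n} \<rightarrow>\<^sub>E UNIV) \<rightarrow> Lp_space p d \<and>
        (\<forall>f\<in>F. Lp_norm p d (\<lambda>t. f t - \<phi> (\<lambda>i\<in>{..<n}. f (x i)) t) \<le> \<epsilon>))"

text \<open>Equal to \<open>\<infinity>\<close> if no number of samples suffices.\<close>

definition complexity ::
  "real \<Rightarrow> ((nat \<Rightarrow> real) \<Rightarrow> complex) set \<Rightarrow> real \<Rightarrow> nat \<Rightarrow> enat" where
  "complexity \<epsilon> F p d = Inf (enat ` {n. recoverable \<epsilon> F p d n})"

end

theory Submission
  imports Defs "HOL-Probability.Probability"
begin

text \<open>
Two members of the class that agree at the sample points must be close in \<open>L\<^sub>p\<close>; then any member matching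
the observed data is a valid reconstruction. So the task is to find few points such that a difference \<open>h\<close>
of two members vanishing there has \<open>L\<^sub>p\<close> norm at most \<open>\<epsilon>\<close>.

The weights of the class make the frequencies beyond \<open>exp (64 / \<epsilon>)\<close> negligible in the supremum norm
(\<open>fourier_partial_sum_error\<close>). Up to a constant factor, the rest of \<open>h\<close> is a convex combination of \<open>N\<close> functions of absolute value
\<open>1\<close>, namely the exponentials rotated by fourth roots of unity (\<open>phase_dictionary\<close>), and \<open>ln N\<close> is of order
\<open>d / \<epsilon>\<close>. What remains is a statement about convex hulls of finite bounded dictionaries
(\<open>exists_norming_points\<close>).

There the scales are separated. If the integral of \<open>norm h powr p\<close> exceeds \<open>\<epsilon> powr p\<close>, then \<open>norm h\<close>
exceeds some dyadic level \<open>u\<close> on a set whose measure is of order \<open>(\<epsilon> / u) powr p / ln (1 / \<epsilon>)\<close> or more. At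
precision \<open>u / 4\<close>, outside a small exceptional set, a convex combination can be replaced by an average of about
\<open>ln (1 / \<epsilon>) / u\<^sup>2\<close> members of the dictionary (\<open>Maurey_approximation\<close>), so a union bound over
\<open>exp (ln N * ln (1 / \<epsilon>) / u\<^sup>2)\<close> sets suffices to make the sample points meet all of them
(\<open>exists_points_hitting\<close>). Coarse levels have small sets but few averages, fine levels large sets but many
averages; the required number of points is of order \<open>u powr (p - 2) * \<epsilon> powr (- p) * (ln (1 / \<epsilon>))\<^sup>2 * ln N\<close>, and for
\<open>p \<ge> 2\<close> this is at most of order \<open>d * \<epsilon> powr (- p - 1) * (ln (1 / \<epsilon>))\<^sup>2\<close>, hence of the claimed order.

Both probabilistic choices, of the points and of the averages, are made greedily, by keeping an exponential
potential from growing faster than it does on average.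

That the Fourier coefficients of a continuous function determine its values in the open cube
is obtained from the Fejer kernel and Korovkin's test functions (\<open>fejer_mean_tendsto\<close>). Almost all points are
interior, so the sample points can be taken there.
\<close>

section \<open>Points that hit every large set often\<close>

lemma (in prob_space) exists_le_expectation:
  fixes F :: "'a \<Rightarrow> real"
  assumes F: "integrable M F" and P: "AE x in M. P x"
  shows "\<exists>x\<in>space M. P x \<and> F x \<le> expectation F"
proof (rule ccontr)
  assume "\<not> ?thesis"
  then have gt: "expectation F < F x" if "x \<in> space M" "P x" for x
    using that by (auto simp: not_le)
  have "AE x in M. expectation F < F x"
    using P AE_space[of M] by eventually_elim (rule gt)
  moreover have "emeasure M (space M) \<noteq> 0"
    by (simp add: emeasure_space_1)
  ultimately have "(LINT x|M. expectation F) < expectation F"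
    using F by (intro integral_less_AE_space) auto
  then show False
    by (simp add: prob_space)
qed

text \<open>The factor by which the potential of the next lemma changes on average at one step: it stays
at most \<open>1\<close> because \<open>1 - exp (-1) \<ge> 1/2\<close>.\<close>

lemma exp_half_sub_indicator_le:
  fixes \<tau> q :: real
  assumes "0 \<le> \<tau>" "\<tau> \<le> q"
  shows "exp (\<tau> / 2) * (1 - (1 - exp (-1)) * q) \<le> 1"
proof -
  have "exp (1::real) \<ge> 2"
    using exp_ge_add_one_self[of "1::real"] by simp
  then have "exp (-1::real) \<le> 1/2"
    by (simp add: exp_minus field_simps)
  then have "(1/2) * \<tau> \<le> (1 - exp (-1)) * q"
    using assms by (intro mult_mono) auto
  then have "1 - (1 - exp (-1)) * q \<le> 1 + (- \<tau> / 2)"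
    by simp
  also have "\<dots> \<le> exp (- \<tau> / 2)"
    by (rule exp_ge_add_one_self)
  finally have "exp (\<tau> / 2) * (1 - (1 - exp (-1)) * q) \<le> exp (\<tau> / 2) * exp (- \<tau> / 2)"
    by (intro mult_left_mono) auto
  then show ?thesis
    by (simp flip: exp_add)
qed

text \<open>A derandomised Chernoff bound with a union bound over finitely many sets. The potential
\<open>\<Sum>i. exp (\<tau> i * m / 2 - hits after m points - n * \<tau> i / 4)\<close> does not grow on average when a further
random point is added, so some choice of that point keeps it below its initial value, which is
less than \<open>1\<close> by assumption. After \<open>n\<close> points every single term is below \<open>1\<close>, and this is the
claimed number of hits. Choosing the points one by one also lets them satisfy any condition \<open>P\<close>
that holds almost everywhere.\<close>

lemma (in prob_space) exists_points_hitting: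
  fixes A :: "'i \<Rightarrow> 'a set" and \<tau> :: "'i \<Rightarrow> real" and n :: nat
  assumes fin: "finite I"
    and A: "\<And>i. i \<in> I \<Longrightarrow> A i \<in> events"
    and \<tau>: "\<And>i. i \<in> I \<Longrightarrow> 0 \<le> \<tau> i" "\<And>i. i \<in> I \<Longrightarrow> \<tau> i \<le> prob (A i)"
    and P: "AE x in M. P x"
    and small: "(\<Sum>i\<in>I. exp (- (real n * \<tau> i / 4))) < 1"
  shows "\<exists>y :: nat \<Rightarrow> 'a. (\<forall>l<n. y l \<in> space M \<and> P (y l)) \<and>
           (\<forall>i\<in>I. real n * \<tau> i / 4 < real (card {l\<in>{..<n}. y l \<in> A i}))"
proof -
  define c where "c i = exp (- (real n * \<tau> i / 4))" for i
  define hits :: "(nat \<Rightarrow> 'a) \<Rightarrow> nat \<Rightarrow> 'i \<Rightarrow> real"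
    where "hits y m i = (\<Sum>l<m. indicator (A i) (y l))" for y m i
  define pot :: "(nat \<Rightarrow> 'a) \<Rightarrow> nat \<Rightarrow> real"
    where "pot y m = (\<Sum>i\<in>I. c i * exp (real m * \<tau> i / 2 - hits y m i))" for y m
  have step: "\<exists>y. (\<forall>l<m. y l \<in> space M \<and> P (y l)) \<and> pot y m \<le> (\<Sum>i\<in>I. c i)" for m
  proof (induction m)
    case 0
    then show ?case
      by (simp add: pot_def hits_def)
  next
    case (Suc m)
    then obtain y where y: "\<And>l. l < m \<Longrightarrow> y l \<in> space M \<and> P (y l)"
      and pot_le: "pot y m \<le> (\<Sum>i\<in>I. c i)"
      by blast
    define W where "W i = c i * exp (real m * \<tau> i / 2 - hits y m i)" for i
    define F where
      "F x = (\<Sum>i\<in>I. W i * exp (\<tau> i / 2) * (1 - (1 - exp (-1)) * indicator (A i) x))" for x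
    have ind: "integrable M (indicator (A i) :: 'a \<Rightarrow> real)" if "i \<in> I" for i
      using A[OF that] by (simp add: emeasure_eq_measure)
    have intF: "integrable M F"
      unfolding F_def using ind by (intro Bochner_Integration.integrable_sum) auto
    have "expectation F = (\<Sum>i\<in>I. W i * (exp (\<tau> i / 2) * (1 - (1 - exp (-1)) * prob (A i))))"
      unfolding F_def using ind A
      by (subst Bochner_Integration.integral_sum)
         (auto intro!: sum.cong simp: prob_space mult.assoc)
    also have "\<dots> \<le> (\<Sum>i\<in>I. W i * 1)"
      using \<tau> by (intro sum_mono mult_left_mono exp_half_sub_indicator_le) (auto simp: W_def c_def)
    finally have "expectation F \<le> (\<Sum>i\<in>I. c i)"
      using pot_le by (simp add: W_def pot_def)
    then obtain x where x: "x \<in> space M" "P x" "F x \<le> (\<Sum>i\<in>I. c i)"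
      using exists_le_expectation[OF intF P] by force
    define y' where "y' = y(m := x)"
    have hits': "hits y' (Suc m) i = hits y m i + indicator (A i) x" for i
      by (simp add: hits_def y'_def)
    have "pot y' (Suc m) = F x"
      unfolding pot_def F_def
    proof (rule sum.cong)
      fix i assume "i \<in> I"
      have ind_exp: "1 - (1 - exp (-1)) * indicator (A i) x = exp (- indicator (A i) x :: real)"
        by (simp add: indicator_def)
      have exponent: "real (Suc m) * \<tau> i / 2 - hits y' (Suc m) i =
          (real m * \<tau> i / 2 - hits y m i) + \<tau> i / 2 + (- indicator (A i) x)"
        by (simp add: hits' add_divide_distrib algebra_simps)
      show "c i * exp (real (Suc m) * \<tau> i / 2 - hits y' (Suc m) i) =
          W i * exp (\<tau> i / 2) * (1 - (1 - exp (-1)) * indicator (A i) x)"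
        unfolding W_def exponent ind_exp exp_add by (simp only: mult.assoc)
    qed simp
    moreover have "\<forall>l<Suc m. y' l \<in> space M \<and> P (y' l)"
      using x y by (simp add: y'_def less_Suc_eq)
    ultimately show ?case
      using x(3) by (intro exI[of _ y']) simp
  qed
  obtain y where y: "\<forall>l<n. y l \<in> space M \<and> P (y l)" and pot: "pot y n \<le> (\<Sum>i\<in>I. c i)"
    using step[of n] by blast
  have "real n * \<tau> i / 4 < real (card {l\<in>{..<n}. y l \<in> A i})" if i: "i \<in> I" for i
  proof -
    have "c i * exp (real n * \<tau> i / 2 - hits y n i) \<le> pot y n"
      unfolding pot_def using i fin
      by (intro member_le_sum[of i I "\<lambda>i. c i * exp (real n * \<tau> i / 2 - hits y n i)"])
         (auto simp: c_def)
    also have "\<dots> < 1"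
      using pot small by (simp add: c_def)
    finally have "exp (real n * \<tau> i / 4 - hits y n i) < exp 0"
      unfolding c_def by (simp flip: exp_add add: field_simps)
    then have "real n * \<tau> i / 4 < hits y n i"
      by simp
    also have "hits y n i = real (card {l\<in>{..<n}. y l \<in> A i})"
      unfolding hits_def by (simp add: indicator_def if_distrib sum.If_cases Int_def conj_commute)
    finally show ?thesis .
  qed
  with y show ?thesis
    by blast
qed

section \<open>Sparse averages near a convex combination\<close>

lemma exp_le_quadratic:
  fixes x :: real
  assumes "\<bar>x\<bar> \<le> 1"
  shows "exp x \<le> 1 + x + x\<^sup>2"
proof (cases "0 \<le> x")
  case True
  then show ?thesis
    using assms exp_bound by auto
next
  case False
  have "(1 - x) * exp x \<le> exp (- x) * exp x"
    using exp_ge_add_one_self[of "- x"] by (intro mult_right_mono) auto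
  then have "exp x \<le> 1 / (1 - x)"
    using False by (simp add: exp_minus field_simps)
  also have "\<dots> \<le> 1 + x + x\<^sup>2"
  proof -
    have "1 \<le> 1 - x * x\<^sup>2"
      using False by (simp add: mult_nonpos_nonneg)
    also have "1 - x * x\<^sup>2 = (1 + x + x\<^sup>2) * (1 - x)"
      by (simp add: algebra_simps power2_eq_square)
    finally show ?thesis
      using False by (simp add: pos_divide_le_eq)
  qed
  finally show ?thesis .
qed

text \<open>A crude form of Hoeffding's lemma: the linear term of the quadratic bound for \<open>exp\<close> disappears
because the weighted mean of \<open>y\<close> is zero.\<close>

lemma convex_combination_exp_le:
  fixes y :: "'k \<Rightarrow> real"
  assumes w: "\<And>k. k \<in> K \<Longrightarrow> 0 \<le> w k" "sum w K = 1"
    and y: "\<And>k. k \<in> K \<Longrightarrow> \<bar>y k\<bar> \<le> 2" "(\<Sum>k\<in>K. w k * y k) = 0"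
    and small: "\<bar>lam\<bar> \<le> 1 / 2"
  shows "(\<Sum>k\<in>K. w k * exp (lam * y k)) \<le> exp (4 * lam\<^sup>2)"
proof -
  have "exp (lam * y k) \<le> 1 + lam * y k + 4 * lam\<^sup>2" if "k \<in> K" for k
  proof -
    have "\<bar>lam * y k\<bar> \<le> (1/2) * 2"
      unfolding abs_mult using small y(1)[OF that] by (intro mult_mono) auto
    then have "exp (lam * y k) \<le> 1 + lam * y k + (lam * y k)\<^sup>2"
      by (intro exp_le_quadratic) simp
    moreover have "(y k)\<^sup>2 \<le> 2\<^sup>2"
      using y(1)[OF that] by (intro abs_le_square_iff[THEN iffD1]) simp
    then have "lam\<^sup>2 * (y k)\<^sup>2 \<le> lam\<^sup>2 * 4"
      by (intro mult_left_mono) auto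
    ultimately show ?thesis
      by (simp add: power_mult_distrib)
  qed
  then have "(\<Sum>k\<in>K. w k * exp (lam * y k)) \<le> (\<Sum>k\<in>K. w k * (1 + lam * y k + 4 * lam\<^sup>2))"
    using w by (intro sum_mono mult_left_mono) auto
  also have "\<dots> = sum w K + lam * (\<Sum>k\<in>K. w k * y k) + 4 * lam\<^sup>2 * sum w K"
    by (simp add: distrib_left sum.distrib sum_distrib_left sum_distrib_right mult_ac)
  also have "\<dots> \<le> exp (4 * lam\<^sup>2)"
    using w(2) y(2) exp_ge_add_one_self[of "4 * lam\<^sup>2"] by (simp add: add.commute)
  finally show ?thesis .
qed

lemma convex_combination_cosh_le:
  fixes y :: "'k \<Rightarrow> real"
  assumes w: "\<And>k. k \<in> K \<Longrightarrow> 0 \<le> w k" "sum w K = 1"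
    and y: "\<And>k. k \<in> K \<Longrightarrow> \<bar>y k\<bar> \<le> 2" "(\<Sum>k\<in>K. w k * y k) = 0"
    and small: "\<bar>lam\<bar> \<le> 1 / 2"
  shows "(\<Sum>k\<in>K. w k * cosh (lam * (S + y k))) \<le> exp (4 * lam\<^sup>2) * cosh (lam * S)"
proof -
  have cosh_split: "cosh (lam * (S + y k)) =
      (exp (lam * S) * exp (lam * y k) + exp (- (lam * S)) * exp ((-lam) * y k)) / 2" for k
    by (simp add: cosh_field_def distrib_left flip: exp_add)
  have "(\<Sum>k\<in>K. w k * cosh (lam * (S + y k))) =
      (\<Sum>k\<in>K. (exp (lam * S) * (w k * exp (lam * y k)) +
        exp (- (lam * S)) * (w k * exp ((-lam) * y k))) / 2)"
    unfolding cosh_split by (intro sum.cong refl) (simp only: times_divide_eq_right distrib_left mult_ac)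
  also have "\<dots> =
      (exp (lam * S) * (\<Sum>k\<in>K. w k * exp (lam * y k)) +
       exp (- (lam * S)) * (\<Sum>k\<in>K. w k * exp ((-lam) * y k))) / 2"
    by (simp only: sum_distrib_left sum.distrib flip: sum_divide_distrib)
  also have "\<dots> \<le> (exp (lam * S) * exp (4 * lam\<^sup>2) + exp (- (lam * S)) * exp (4 * (-lam)\<^sup>2)) / 2"
    using assms
    by (intro divide_right_mono add_mono mult_left_mono convex_combination_exp_le) auto
  also have "\<dots> = exp (4 * lam\<^sup>2) * cosh (lam * S)"
    by (simp add: cosh_field_def algebra_simps)
  finally show ?thesis .
qed

lemma convex_combination_exists_le:
  fixes a :: "'k \<Rightarrow> real"
  assumes "finite K" and w: "\<And>k. k \<in> K \<Longrightarrow> 0 \<le> w k" "sum w K = 1"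
    and le: "(\<Sum>k\<in>K. w k * a k) \<le> b"
  shows "\<exists>k\<in>K. a k \<le> b"
proof (rule ccontr)
  assume "\<not> ?thesis"
  then have gt: "\<And>k. k \<in> K \<Longrightarrow> b < a k"
    by (auto simp: not_le)
  have "(\<Sum>k\<in>K. w k * (a k - b)) = (\<Sum>k\<in>K. w k * a k) - sum w K * b"
    by (simp add: algebra_simps sum_subtractf sum_distrib_left)
  then have "(\<Sum>k\<in>K. w k * (a k - b)) \<le> 0"
    using le w by simp
  moreover have nn: "\<And>k. k \<in> K \<Longrightarrow> 0 \<le> w k * (a k - b)"
    using w gt by (simp add: less_imp_le)
  ultimately have "(\<Sum>k\<in>K. w k * (a k - b)) = 0"
    by (intro antisym sum_nonneg) auto
  then have "\<forall>k\<in>K. w k * (a k - b) = 0"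
    using \<open>finite K\<close> nn by (simp add: sum_nonneg_eq_0_iff)
  then have "w k = 0" if "k \<in> K" for k
    using gt[OF that] that by auto
  then show False
    using w(2) by simp
qed

text \<open>This function is exponentially large as soon as one of the coordinates of \<open>z\<close> is, in either
direction; its weighted means are controlled by Hoeffding's lemma.\<close>

definition cosh_potential :: "real \<Rightarrow> complex \<Rightarrow> real" where
  "cosh_potential lam z = cosh (lam * Re z) + cosh (lam * Im z)"

lemma borel_measurable_cosh_potential [measurable]: "cosh_potential lam \<in> borel_measurable borel"
  unfolding cosh_potential_def cosh_field_def by measurable

lemma cosh_potential_nonneg: "0 \<le> cosh_potential lam z"
  unfolding cosh_potential_def by (intro add_nonneg_nonneg) (auto simp: cosh_field_def)

lemma cosh_real_le_exp_abs: "cosh x \<le> exp \<bar>x :: real\<bar>"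
  unfolding cosh_field_def by (cases "0 \<le> x") auto

lemma exp_abs_le_cosh_real: "exp \<bar>x :: real\<bar> \<le> 2 * cosh x"
  unfolding cosh_field_def by (cases "0 \<le> x") auto

lemma cosh_potential_le:
  assumes "norm z \<le> R"
  shows "cosh_potential lam z \<le> 2 * exp (\<bar>lam\<bar> * R)"
proof -
  have "cosh (lam * t) \<le> exp (\<bar>lam\<bar> * R)" if "\<bar>t\<bar> \<le> norm z" for t
  proof -
    have "\<bar>lam * t\<bar> \<le> \<bar>lam\<bar> * R"
      unfolding abs_mult using that assms by (intro mult_left_mono) auto
    then show ?thesis
      using cosh_real_le_exp_abs[of "lam * t"] by (meson exp_le_cancel_iff order_trans)
  qed
  from this[of "Re z"] this[of "Im z"] show ?thesis
    unfolding cosh_potential_def by (simp add: abs_Re_le_cmod abs_Im_le_cmod)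
qed

lemma cosh_potential_ge:
  assumes "2 * r \<le> norm z" "0 \<le> lam"
  shows "exp (lam * r) \<le> 2 * cosh_potential lam z"
proof -
  have *: "exp (lam * r) \<le> 2 * cosh (lam * t)" if "r \<le> \<bar>t\<bar>" for t
  proof -
    have "lam * r \<le> lam * \<bar>t\<bar>"
      using that assms by (intro mult_left_mono)
    also have "\<dots> = \<bar>lam * t\<bar>"
      using assms by (simp add: abs_mult)
    finally have "lam * r \<le> \<bar>lam * t\<bar>" .
    then show ?thesis
      using exp_abs_le_cosh_real[of "lam * t"] by (meson exp_le_cancel_iff order_trans)
  qed
  have nn: "0 \<le> cosh x" for x :: real
    by (simp add: cosh_field_def)
  have "r \<le> \<bar>Re z\<bar> \<or> r \<le> \<bar>Im z\<bar>"
    using assms(1) cmod_le[of z] by linarith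
  then show ?thesis
    using *[of "Re z"] *[of "Im z"] nn[of "lam * Re z"] nn[of "lam * Im z"]
    unfolding cosh_potential_def distrib_left by linarith
qed

text \<open>Adding one randomly chosen centred summand raises the mean of the potential by at most the factor
\<open>exp (4 * lam\<^sup>2)\<close>.\<close>

lemma convex_combination_cosh_potential_le:
  fixes z :: "'k \<Rightarrow> complex"
  assumes w: "\<And>k. k \<in> K \<Longrightarrow> 0 \<le> w k" "sum w K = 1"
    and z: "\<And>k. k \<in> K \<Longrightarrow> norm (z k) \<le> 1"
    and lam: "\<bar>lam\<bar> \<le> 1 / 2"
  defines "h \<equiv> \<Sum>k\<in>K. of_real (w k) * z k"
  shows "(\<Sum>k\<in>K. w k * cosh_potential lam (S + (z k - h))) \<le> exp (4 * lam\<^sup>2) * cosh_potential lam S"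
proof -
  have "norm h \<le> (\<Sum>k\<in>K. w k * 1)"
    unfolding h_def using w z
    by (intro sum_norm_le) (auto simp: norm_mult intro!: mult_left_le)
  then have "norm h \<le> 1"
    using w by simp
  then have le2: "norm (z k - h) \<le> 2" if "k \<in> K" for k
    using z[OF that] norm_triangle_ineq4[of "z k" h] by linarith
  have "(\<Sum>k\<in>K. w k * Re (z k - h)) = Re h - sum w K * Re h"
    "(\<Sum>k\<in>K. w k * Im (z k - h)) = Im h - sum w K * Im h"
    by (simp_all add: right_diff_distrib sum_subtractf sum_distrib_right[symmetric] h_def)
  then have mean: "(\<Sum>k\<in>K. w k * Re (z k - h)) = 0" "(\<Sum>k\<in>K. w k * Im (z k - h)) = 0"
    using w by simp_all
  have "(\<Sum>k\<in>K. w k * cosh (lam * (Re S + Re (z k - h)))) \<le> exp (4 * lam\<^sup>2) * cosh (lam * Re S)"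
    using w lam mean le2
    by (intro convex_combination_cosh_le) (auto intro: order_trans[OF abs_Re_le_cmod] simp del: minus_complex.simps)
  moreover
  have "(\<Sum>k\<in>K. w k * cosh (lam * (Im S + Im (z k - h)))) \<le> exp (4 * lam\<^sup>2) * cosh (lam * Im S)"
    using w lam mean le2
    by (intro convex_combination_cosh_le) (auto intro: order_trans[OF abs_Im_le_cmod] simp del: minus_complex.simps)
  ultimately show ?thesis
    unfolding cosh_potential_def by (simp add: distrib_left sum.distrib)
qed

text \<open>Maurey's empirical method: the average of \<open>s\<close> members of the dictionary \<open>v\<close>, drawn independently
with probabilities \<open>w\<close>, deviates from the convex combination by more than \<open>\<eta>\<close> at a given point with
probability of order \<open>exp (- s * \<eta>\<^sup>2 / 64)\<close>. What matters later is that a single average is good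
simultaneously for the measure \<open>M\<close> and for the empirical measure of the points \<open>y\<close>. Both enter the
functional \<open>\<Phi>\<close> below, and the members are chosen one after another so that \<open>\<Phi>\<close> of the potential
grows at most by the mean factor. The exceptional sets are then bounded by Markov's inequality.\<close>

lemma (in prob_space) Maurey_approximation:
  fixes v :: "'k \<Rightarrow> 'a \<Rightarrow> complex" and y :: "nat \<Rightarrow> 'a"
  assumes fin: "finite K"
    and meas: "\<And>k. k \<in> K \<Longrightarrow> v k \<in> borel_measurable M"
    and bound: "\<And>k x. k \<in> K \<Longrightarrow> x \<in> space M \<Longrightarrow> norm (v k x) \<le> 1"
    and w: "\<And>k. k \<in> K \<Longrightarrow> 0 \<le> w k" "sum w K = 1"
    and y: "\<And>l. l < n \<Longrightarrow> y l \<in> space M"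
    and \<eta>: "0 < \<eta>" "\<eta> \<le> 8"
  defines "D \<equiv> \<lambda>\<sigma> s x. (\<Sum>r<s. v (\<sigma> r) x) - of_nat s * (\<Sum>k\<in>K. of_real (w k) * v k x)"
  shows "\<exists>\<sigma>\<in>{..<s} \<rightarrow>\<^sub>E K.
    prob {x\<in>space M. real s * \<eta> < norm (D \<sigma> s x)} +
    real (card {l\<in>{..<n}. real s * \<eta> < norm (D \<sigma> s (y l))}) / real n
      \<le> 8 * exp (- (real s * \<eta>\<^sup>2 / 64))"
proof -
  define h where "h x = (\<Sum>k\<in>K. of_real (w k) * v k x)" for x
  define \<Phi> :: "('a \<Rightarrow> real) \<Rightarrow> real"
    where "\<Phi> F = expectation F + (\<Sum>l<n. F (y l)) / real n" for F
  \<comment> \<open>Minimises the final exponent \<open>4 * lam\<^sup>2 - lam * \<eta> / 2\<close>, with value \<open>- \<eta>\<^sup>2 / 64\<close>.\<close>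
  define lam where "lam = \<eta> / 16"
  have lam: "0 \<le> lam" "\<bar>lam\<bar> \<le> 1/2"
    using \<eta> by (auto simp: lam_def)
  have mono: "\<Phi> F \<le> \<Phi> G"
    if "integrable M F" "integrable M G" "\<And>x. x \<in> space M \<Longrightarrow> F x \<le> G x" for F G
    unfolding \<Phi>_def using that y
    by (intro add_mono integral_mono divide_right_mono sum_mono) auto
  have h_meas: "h \<in> borel_measurable M"
    unfolding h_def using meas by (intro borel_measurable_sum borel_measurable_times) auto
  have h_bound: "norm (h x) \<le> 1" if "x \<in> space M" for x
  proof -
    have "norm (h x) \<le> (\<Sum>k\<in>K. w k * 1)"
      unfolding h_def using w bound that
      by (intro sum_norm_le) (auto simp: norm_mult intro!: mult_left_le)
    then show ?thesis
      using w by simp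
  qed
  have D_eq: "D \<sigma> s x = (\<Sum>r<s. v (\<sigma> r) x - h x)" for \<sigma> s x
    by (simp add: D_def h_def sum_subtractf)
  have D_meas: "D \<sigma> s \<in> borel_measurable M" if "\<sigma> \<in> {..<s} \<rightarrow>\<^sub>E K" for \<sigma> s
    unfolding D_eq[abs_def] using that meas h_meas
    by (intro borel_measurable_sum borel_measurable_diff) (auto simp: PiE_iff)
  have D_bound: "norm (D \<sigma> s x) \<le> real s * 2"
    if "\<sigma> \<in> {..<s} \<rightarrow>\<^sub>E K" "x \<in> space M" for \<sigma> s x
  proof -
    have "norm (v (\<sigma> r) x - h x) \<le> 2" if "r < s" for r
      using bound[of "\<sigma> r" x] h_bound[of x] norm_triangle_ineq4[of "v (\<sigma> r) x" "h x"]
        \<open>\<sigma> \<in> _\<close> \<open>x \<in> space M\<close> that by (force simp: PiE_iff)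
    then have "norm (D \<sigma> s x) \<le> (\<Sum>r<s. 2)"
      unfolding D_eq by (intro sum_norm_le) auto
    then show ?thesis
      by simp
  qed
  have int: "integrable M (\<lambda>x. cosh_potential lam (D \<sigma> s x))" if "\<sigma> \<in> {..<s} \<rightarrow>\<^sub>E K" for \<sigma> s
    using D_bound[OF that] D_meas[OF that] cosh_potential_nonneg
    by (intro integrable_const_bound[where B = "2 * exp (\<bar>lam\<bar> * (real s * 2))"])
       (auto intro!: cosh_potential_le)
  have greedy: "\<exists>\<sigma>\<in>{..<s} \<rightarrow>\<^sub>E K. \<Phi> (\<lambda>x. cosh_potential lam (D \<sigma> s x)) \<le> 4 * exp (4 * lam\<^sup>2) ^ s" for s
  proof (induction s)
    case 0
    have "\<Phi> (\<lambda>x. 2) \<le> 4"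
      by (cases "n = 0") (auto simp: \<Phi>_def prob_space)
    then show ?case
      by (simp add: D_eq cosh_potential_def)
  next
    case (Suc s)
    then obtain \<sigma> where \<sigma>: "\<sigma> \<in> {..<s} \<rightarrow>\<^sub>E K"
      and le: "\<Phi> (\<lambda>x. cosh_potential lam (D \<sigma> s x)) \<le> 4 * exp (4 * lam\<^sup>2) ^ s"
      by blast
    define G where "G k x = cosh_potential lam (D (\<sigma>(s := k)) (Suc s) x)" for k x
    have \<sigma>': "\<sigma>(s := k) \<in> {..<Suc s} \<rightarrow>\<^sub>E K" if "k \<in> K" for k
      using \<sigma> that by (auto simp: PiE_iff extensional_def less_Suc_eq)
    have G_eq: "G k x = cosh_potential lam (D \<sigma> s x + (v k x - h x))" for k x
      by (simp add: G_def D_eq)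
    have G_int: "integrable M (G k)" if "k \<in> K" for k
      unfolding G_def using int[OF \<sigma>'[OF that]] .
    have "(\<Sum>k\<in>K. w k * \<Phi> (G k)) = \<Phi> (\<lambda>x. \<Sum>k\<in>K. w k * G k x)"
    proof -
      have "(\<Sum>k\<in>K. w k * (\<Sum>l<n. G k (y l)) / real n) = (\<Sum>l<n. \<Sum>k\<in>K. w k * G k (y l)) / real n"
        by (subst sum.swap) (simp add: sum_distrib_left sum_divide_distrib)
      moreover have "expectation (\<lambda>x. \<Sum>k\<in>K. w k * G k x) = (\<Sum>k\<in>K. w k * expectation (G k))"
        using G_int by (subst Bochner_Integration.integral_sum) auto
      ultimately show ?thesis
        by (simp add: \<Phi>_def distrib_left sum.distrib)
    qed
    also have "\<dots> \<le> \<Phi> (\<lambda>x. exp (4 * lam\<^sup>2) * cosh_potential lam (D \<sigma> s x))"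
    proof (rule mono)
      show "integrable M (\<lambda>x. \<Sum>k\<in>K. w k * G k x)"
        using G_int by auto
      show "integrable M (\<lambda>x. exp (4 * lam\<^sup>2) * cosh_potential lam (D \<sigma> s x))"
        using int[OF \<sigma>] by auto
      show "(\<Sum>k\<in>K. w k * G k x) \<le> exp (4 * lam\<^sup>2) * cosh_potential lam (D \<sigma> s x)"
        if "x \<in> space M" for x
        unfolding G_eq h_def using w bound[OF _ that] lam
        by (intro convex_combination_cosh_potential_le) auto
    qed
    also have "\<dots> = exp (4 * lam\<^sup>2) * \<Phi> (\<lambda>x. cosh_potential lam (D \<sigma> s x))"
      by (simp add: \<Phi>_def distrib_left sum_distrib_left)
    also have "\<dots> \<le> exp (4 * lam\<^sup>2) * (4 * exp (4 * lam\<^sup>2) ^ s)"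
      using le by (intro mult_left_mono) auto
    finally obtain k where "k \<in> K" "\<Phi> (G k) \<le> 4 * exp (4 * lam\<^sup>2) ^ Suc s"
      using convex_combination_exists_le[OF fin w, of "\<lambda>k. \<Phi> (G k)" "4 * exp (4 * lam\<^sup>2) ^ Suc s"]
      by (auto simp: mult_ac)
    then show ?case
      unfolding G_def using \<sigma>' by blast
  qed
  then obtain \<sigma> where \<sigma>: "\<sigma> \<in> {..<s} \<rightarrow>\<^sub>E K"
    and le: "\<Phi> (\<lambda>x. cosh_potential lam (D \<sigma> s x)) \<le> 4 * exp (4 * lam\<^sup>2) ^ s"
    by blast
  define B where "B = {x\<in>space M. real s * \<eta> < norm (D \<sigma> s x)}"
  define c where "c = 2 * exp (- (lam * (real s * \<eta> / 2)))"
  have B: "B \<in> events"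
    unfolding B_def using D_meas[OF \<sigma>] by measurable
  have "prob B + real (card {l\<in>{..<n}. real s * \<eta> < norm (D \<sigma> s (y l))}) / real n = \<Phi> (indicator B)"
  proof -
    have "{l\<in>{..<n}. real s * \<eta> < norm (D \<sigma> s (y l))} = {..<n} \<inter> {l. y l \<in> B}"
      using y by (auto simp: B_def)
    then show ?thesis
      using B by (simp add: \<Phi>_def indicator_def sum.If_cases flip: of_bool_def)
  qed
  also have "\<Phi> (indicator B) \<le> \<Phi> (\<lambda>x. c * cosh_potential lam (D \<sigma> s x))"
  proof (rule mono)
    show "integrable M (indicator B :: 'a \<Rightarrow> real)"
      using B by (simp add: emeasure_eq_measure)
    show "integrable M (\<lambda>x. c * cosh_potential lam (D \<sigma> s x))"
      using int[OF \<sigma>] by auto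
    show "indicator B x \<le> c * cosh_potential lam (D \<sigma> s x)" if "x \<in> space M" for x
    proof (cases "x \<in> B")
      case True
      then have "exp (lam * (real s * \<eta> / 2)) \<le> 2 * cosh_potential lam (D \<sigma> s x)"
        using lam by (intro cosh_potential_ge) (auto simp: B_def)
      then show ?thesis
        using True by (simp add: c_def exp_minus field_simps)
    qed (use cosh_potential_nonneg in \<open>auto simp: c_def\<close>)
  qed
  also have "\<dots> = c * \<Phi> (\<lambda>x. cosh_potential lam (D \<sigma> s x))"
    by (simp add: \<Phi>_def distrib_left sum_distrib_left)
  also have "\<dots> \<le> c * (4 * exp (4 * lam\<^sup>2) ^ s)"
    using le by (intro mult_left_mono) (auto simp: c_def)
  also have "\<dots> = 8 * exp (real s * (4 * lam\<^sup>2) - lam * (real s * \<eta> / 2))"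
  proof -
    have "exp (4 * lam\<^sup>2) ^ s = exp (real s * (4 * lam\<^sup>2))"
      by (rule exp_of_nat_mult[symmetric])
    then show ?thesis
      unfolding c_def diff_conv_add_uminus exp_add by simp
  qed
  also have "real s * (4 * lam\<^sup>2) - lam * (real s * \<eta> / 2) = - (real s * \<eta>\<^sup>2 / 64)"
    by (simp add: lam_def power2_eq_square field_simps)
  finally show ?thesis
    using \<sigma> unfolding B_def by blast
qed

section \<open>Norming points for the convex hull of a dictionary\<close>

text \<open>The first level \<open>1 / 2 ^ j\<close> below \<open>z\<close> determines \<open>z\<close> up to a factor \<open>2\<close>; the level before it, or the
bound \<open>2\<close> when \<open>j = 0\<close>, is the reason why \<open>z\<close> is not larger.\<close>

lemma dyadic_layer_bound:
  fixes z p \<epsilon> :: real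
  assumes p: "0 < p" and \<epsilon>: "1 / 2 ^ J \<le> \<epsilon> / 2" and z: "0 \<le> z" "z \<le> 2"
  shows "z powr p \<le> (\<epsilon> / 2) powr p + (\<Sum>j\<le>J. (2 * (1 / 2 ^ j)) powr p * of_bool (1 / 2 ^ j < z))"
proof (cases "z \<le> 1 / 2 ^ J")
  case True
  then have "z powr p \<le> (\<epsilon> / 2) powr p"
    using z p \<epsilon> by (intro powr_mono2) auto
  moreover have "0 \<le> (\<Sum>j\<le>J. (2 * (1 / 2 ^ j)) powr p * of_bool (1 / 2 ^ j < z))"
    by (intro sum_nonneg) auto
  ultimately show ?thesis
    by linarith
next
  case False
  define j where "j = (LEAST j. 1 / 2 ^ j < z)"
  have J: "1 / 2 ^ J < z"
    using False by simp
  have j: "1 / 2 ^ j < z" "j \<le> J"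
    unfolding j_def using J by (rule LeastI, rule Least_le)
  have "z \<le> 2 * (1 / 2 ^ j)"
  proof (cases j)
    case (Suc i)
    then have "\<not> 1 / 2 ^ i < z"
      using not_less_Least[of i "\<lambda>j. 1 / 2 ^ j < z"] by (simp add: j_def)
    then show ?thesis
      using Suc by simp
  qed (use z in simp)
  then have "z powr p \<le> (2 * (1 / 2 ^ j)) powr p * of_bool (1 / 2 ^ j < z)"
    using z p j by (simp add: powr_mono2)
  also have "\<dots> \<le> (\<Sum>j\<le>J. (2 * (1 / 2 ^ j)) powr p * of_bool (1 / 2 ^ j < z))"
    using j by (intro member_le_sum[of j "{..J}"
        "\<lambda>j. (2 * (1 / 2 ^ j)) powr p * of_bool (1 / 2 ^ j < z)"]) auto
  finally show ?thesis
    by (intro add_increasing) auto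
qed

lemma sum_half_powers_less_one: "(\<Sum>j\<le>J. (1 / 2 :: real) ^ Suc j) < 1"
proof -
  have "(\<Sum>j\<le>J. (1 / 2 :: real) ^ Suc j) = 1 - (1 / 2) ^ Suc J"
    by (induction J) auto
  then show ?thesis
    by simp
qed

text \<open>If a function with values of norm at most \<open>2\<close> exceeds the level \<open>1 / 2 ^ j\<close> in norm only on a set of
measure at most \<open>level_mass p \<epsilon> J j\<close>, for each \<open>j \<le> J\<close>, then the levels together contribute at most
\<open>\<epsilon> powr p / 2\<close> to the integral of its \<open>p\<close>-th power.\<close>

definition level_mass :: "real \<Rightarrow> real \<Rightarrow> nat \<Rightarrow> nat \<Rightarrow> real" where
  "level_mass p \<epsilon> J j = \<epsilon> powr p / (2 * (real J + 1) * (2 * (1 / 2 ^ j)) powr p)"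

text \<open>Points at which every function \<open>h\<close> close to the convex hull of the dictionary is seen, unless the
\<open>p\<close>-norm of \<open>h\<close> is small. The points are chosen to hit often every set on which a sparse average is
larger than \<open>5/8\<close> of its level \<open>u\<close>, provided the measure of that set is at least half the level mass.
There are at most \<open>card K ^ s j\<close> sparse averages on level \<open>j\<close>, which is what the assumption on \<open>n\<close> pays for.

If the integral is large, then \<open>h\<close> exceeds some level \<open>u\<close> on a set with more than the level
mass. A sparse average is within \<open>u / 4\<close> of the convex combination, and the latter within \<open>u / 8\<close> of
\<open>h\<close>, with exceptions that are rare for \<open>M\<close> and rare among the sample points. Rarity for \<open>M\<close> puts the
average among those whose large values are hit often; rarity among the sample points leaves at least one of
these hits unexceptional, and there \<open>h\<close> does not vanish. The sparse average depends on the points, but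
the points serve all sparse averages at once.\<close>

lemma (in prob_space) exists_norming_points:
  fixes v :: "'k \<Rightarrow> 'a \<Rightarrow> complex" and s :: "nat \<Rightarrow> nat"
  assumes fin: "finite K" and card_K: "2 \<le> card K"
    and meas: "\<And>k. k \<in> K \<Longrightarrow> v k \<in> borel_measurable M"
    and bound: "\<And>k x. k \<in> K \<Longrightarrow> x \<in> space M \<Longrightarrow> norm (v k x) \<le> 1"
    and P: "AE x in M. P x"
    and p: "1 \<le> p"
    and \<epsilon>: "0 < \<epsilon>" "\<epsilon> \<le> 1" "1 / 2 ^ J \<le> \<epsilon> / 2" "\<epsilon> / 4 \<le> 1 / 2 ^ J"
    and s: "\<And>j. j \<le> J \<Longrightarrow> Suc j \<le> s j"
      "\<And>j. j \<le> J \<Longrightarrow> 8 * exp (- (real (s j) * (1 / 2 ^ j / 4)\<^sup>2 / 64)) \<le> level_mass p \<epsilon> J j / 8"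
    and n: "\<And>j. j \<le> J \<Longrightarrow> 2 * real (s j) * ln (real (card K)) \<le> real n * level_mass p \<epsilon> J j / 8"
  shows "\<exists>y :: nat \<Rightarrow> 'a. (\<forall>l<n. y l \<in> space M \<and> P (y l)) \<and>
    (\<forall>h w. h \<in> borel_measurable M \<longrightarrow> (\<forall>k\<in>K. 0 \<le> w k) \<longrightarrow> sum w K = 1 \<longrightarrow>
       (\<forall>x\<in>space M. P x \<longrightarrow> norm (h x - (\<Sum>k\<in>K. of_real (w k) * v k x)) \<le> \<epsilon> / 32) \<longrightarrow>
       (\<forall>l<n. h (y l) = 0) \<longrightarrow> expectation (\<lambda>x. norm (h x) powr p) \<le> \<epsilon> powr p)"
proof -
  define u :: "nat \<Rightarrow> real" where "u j = 1 / 2 ^ j" for j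
  define t where "t = level_mass p \<epsilon> J"
  have u: "0 < u j" "u j \<le> 1" for j
    by (simp_all add: u_def)
  have u_ge: "\<epsilon> / 4 \<le> u j" if "j \<le> J" for j
    using order_trans[OF \<epsilon>(4) power_decreasing[OF that, of "1/2 :: real", unfolded power_one_over]]
    by (simp add: u_def)
  have t_pos: "0 < t j" for j
    using \<epsilon> by (simp add: t_def level_mass_def)
  define avg where "avg \<sigma> j x = (\<Sum>r<s j. v (\<sigma> r) x) / of_nat (s j)" for \<sigma> j x
  define A where "A = (\<lambda>(j, \<sigma>). {x\<in>space M. 5 / 8 * u j < norm (avg \<sigma> j x)})"
  define Net where "Net j = {..<s j} \<rightarrow>\<^sub>E K" for j
  define I where "I = Sigma {..J} (\<lambda>j. {\<sigma>\<in>Net j. t j / 2 \<le> prob (A (j, \<sigma>))})"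
  have fin_Net: "finite (Net j)" for j
    unfolding Net_def using fin by (intro finite_PiE) auto
  have fin_I: "finite I"
    unfolding I_def using fin_Net by auto
  have A: "A (j, \<sigma>) \<in> events" if "\<sigma> \<in> Net j" for j \<sigma>
  proof -
    have "avg \<sigma> j \<in> borel_measurable M"
      unfolding avg_def using that meas
      by (intro borel_measurable_divide borel_measurable_sum) (auto simp: Net_def PiE_iff)
    then show ?thesis
      unfolding A_def by simp
  qed
  have "(\<Sum>i\<in>I. exp (- (real n * (t (fst i) / 2) / 4))) =
      (\<Sum>j\<le>J. \<Sum>\<sigma> | \<sigma> \<in> Net j \<and> t j / 2 \<le> prob (A (j, \<sigma>)). exp (- (real n * t j / 8)))"
    unfolding I_def using fin_Net by (subst sum.Sigma) (auto simp: case_prod_unfold)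
  also have "\<dots> \<le> (\<Sum>j\<le>J. (1 / 2) ^ Suc j)"
  proof (rule sum_mono)
    fix j assume j: "j \<in> {..J}"
    have "card {\<sigma> \<in> Net j. t j / 2 \<le> prob (A (j, \<sigma>))} \<le> card (Net j)"
      using fin_Net by (intro card_mono) auto
    also have "\<dots> = card K ^ s j"
      by (simp add: Net_def card_PiE)
    finally have "(\<Sum>\<sigma> | \<sigma> \<in> Net j \<and> t j / 2 \<le> prob (A (j, \<sigma>)). exp (- (real n * t j / 8)))
        \<le> real (card K ^ s j) * exp (- (real n * t j / 8))"
      by (simp add: mult_right_mono flip: of_nat_power)
    also have "\<dots> \<le> real (card K ^ s j) * exp (- (2 * real (s j) * ln (real (card K))))"
      using n[of j] j by (intro mult_left_mono) (auto simp: t_def)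
    also have "\<dots> = real (card K ^ s j) * (1 / real (card K ^ s j))\<^sup>2"
    proof -
      have "exp (real (s j) * ln (real (card K))) = real (card K ^ s j)"
        using card_K by (simp add: exp_of_nat_mult)
      then have "exp (2 * (real (s j) * ln (real (card K)))) = (real (card K ^ s j))\<^sup>2"
        by (metis exp_double)
      then show ?thesis
        by (simp add: exp_minus power_divide mult.assoc inverse_eq_divide)
    qed
    also have "\<dots> = (1 / real (card K)) ^ s j"
      using card_K by (simp add: power2_eq_square power_divide)
    also have "\<dots> \<le> (1 / 2) ^ s j"
      using card_K by (intro power_mono) (auto simp: field_simps)
    also have "\<dots> \<le> (1 / 2) ^ Suc j"
      using s(1)[of j] j by (intro power_decreasing) auto
    finally show "(\<Sum>\<sigma> | \<sigma> \<in> Net j \<and> t j / 2 \<le> prob (A (j, \<sigma>)). exp (- (real n * t j / 8)))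
        \<le> (1 / 2) ^ Suc j" .
  qed
  also have "\<dots> < 1"
    by (rule sum_half_powers_less_one)
  finally have small: "(\<Sum>i\<in>I. exp (- (real n * (t (fst i) / 2) / 4))) < 1" .
  have "\<exists>y. (\<forall>l<n. y l \<in> space M \<and> P (y l)) \<and>
      (\<forall>i\<in>I. real n * (t (fst i) / 2) / 4 < real (card {l\<in>{..<n}. y l \<in> A i}))"
    using A t_pos by (intro exists_points_hitting[OF fin_I _ _ _ P small])
      (auto simp: I_def less_imp_le)
  then obtain y where y: "\<And>l. l < n \<Longrightarrow> y l \<in> space M \<and> P (y l)"
    and hits: "\<And>i. i \<in> I \<Longrightarrow> real n * (t (fst i) / 2) / 4 < real (card {l\<in>{..<n}. y l \<in> A i})"
    by blast
  have "expectation (\<lambda>x. norm (h x) powr p) \<le> \<epsilon> powr p"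
    if h: "h \<in> borel_measurable M" and w: "\<forall>k\<in>K. 0 \<le> w k" "sum w K = 1"
      and approx: "\<forall>x\<in>space M. P x \<longrightarrow> norm (h x - (\<Sum>k\<in>K. of_real (w k) * v k x)) \<le> \<epsilon> / 32"
      and zero: "\<forall>l<n. h (y l) = 0"
    for h w
  proof -
    define g where "g x = (\<Sum>k\<in>K. of_real (w k) * v k x)" for x
    define S where "S j = {x\<in>space M. u j < norm (h x)}" for j
    have S: "S j \<in> events" for j
      unfolding S_def using h by measurable
    have g_bound: "norm (g x) \<le> 1" if "x \<in> space M" for x
    proof -
      have "norm (g x) \<le> (\<Sum>k\<in>K. w k * 1)"
        unfolding g_def using w bound that
        by (intro sum_norm_le) (auto simp: norm_mult intro!: mult_left_le)
      then show ?thesis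
        using w by simp
    qed
    have h_bound: "norm (h x) \<le> 2" if "x \<in> space M" "P x" for x
      using approx[rule_format, OF that] g_bound[OF that(1)] \<epsilon> norm_triangle_sub[of "h x" "g x"]
      unfolding g_def by linarith
    have S_small: "prob (S j) \<le> t j" if j: "j \<le> J" for j
    proof (rule ccontr)
      assume big: "\<not> prob (S j) \<le> t j"
      define Bad where "Bad \<sigma> x \<longleftrightarrow> real (s j) * (u j / 4) <
        norm ((\<Sum>r<s j. v (\<sigma> r) x) - of_nat (s j) * g x)" for \<sigma> x
      have sj: "0 < s j"
        using s(1)[OF j] by simp
      have avg_close: "norm (avg \<sigma> j x - g x) \<le> u j / 4" if "\<not> Bad \<sigma> x" for \<sigma> x
      proof -
        have "(\<Sum>r<s j. v (\<sigma> r) x) - of_nat (s j) * g x = of_nat (s j) * (avg \<sigma> j x - g x)"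
          using sj by (simp add: avg_def field_simps)
        then have "real (s j) * norm (avg \<sigma> j x - g x) \<le> real (s j) * (u j / 4)"
          using that by (simp add: Bad_def norm_mult not_less)
        then show ?thesis
          using sj by simp
      qed
      have h_close: "norm (h x - g x) \<le> u j / 8" if "x \<in> space M" "P x" for x
        using approx that u_ge[OF j] unfolding g_def by fastforce
      obtain \<sigma> where \<sigma>: "\<sigma> \<in> Net j"
        and "prob {x\<in>space M. Bad \<sigma> x} + real (card {l\<in>{..<n}. Bad \<sigma> (y l)}) / real n
          \<le> 8 * exp (- (real (s j) * (u j / 4)\<^sup>2 / 64))"
        using Maurey_approximation[of K v w n y "u j / 4" "s j", OF fin meas bound _ w(2)] w(1) y u[of j]
        unfolding Bad_def g_def Net_def by fastforce
      moreover have "8 * exp (- (real (s j) * (u j / 4)\<^sup>2 / 64)) \<le> t j / 8"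
        using s(2)[OF j] by (simp add: u_def t_def)
      ultimately have bad_sum:
        "prob {x\<in>space M. Bad \<sigma> x} + real (card {l\<in>{..<n}. Bad \<sigma> (y l)}) / real n \<le> t j / 8"
        by linarith
      have bad_prob: "prob {x\<in>space M. Bad \<sigma> x} \<le> t j / 8"
        and "real (card {l\<in>{..<n}. Bad \<sigma> (y l)}) / real n \<le> t j / 8"
        using bad_sum measure_nonneg[of M "{x\<in>space M. Bad \<sigma> x}"]
        by (auto simp: add_increasing intro: order_trans[rotated])
      then have bad_card: "real (card {l\<in>{..<n}. Bad \<sigma> (y l)}) \<le> real n * t j / 8"
        by (cases "n = 0") (auto simp: field_simps)
      have Bad_meas: "{x\<in>space M. Bad \<sigma> x} \<in> events"
      proof -
        have "(\<lambda>x. (\<Sum>r<s j. v (\<sigma> r) x) - of_nat (s j) * g x) \<in> borel_measurable M"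
          unfolding g_def using \<sigma> meas
          by (intro borel_measurable_diff borel_measurable_sum borel_measurable_times)
             (auto simp: Net_def PiE_iff)
        then show ?thesis
          unfolding Bad_def by measurable
      qed
      have "prob (S j) \<le> prob (A (j, \<sigma>) \<union> {x\<in>space M. Bad \<sigma> x})"
      proof (rule finite_measure_mono_AE)
        show "AE x in M. x \<in> S j \<longrightarrow> x \<in> A (j, \<sigma>) \<union> {x\<in>space M. Bad \<sigma> x}"
          using P AE_space[of M]
        proof eventually_elim
          case (elim x)
          show ?case
          proof (intro impI)
            assume "x \<in> S j"
            then have "u j < norm (h x)"
              by (simp add: S_def)
            moreover have "norm (h x) \<le> norm (h x - g x) + norm (avg \<sigma> j x - g x) + norm (avg \<sigma> j x)"
              using norm_triangle_sub[of "h x" "g x"] norm_triangle_sub[of "g x" "avg \<sigma> j x"]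
              by (simp add: norm_minus_commute)
            ultimately show "x \<in> A (j, \<sigma>) \<union> {x\<in>space M. Bad \<sigma> x}"
              using elim h_close[of x] avg_close[of \<sigma> x]
              unfolding A_def by (cases "Bad \<sigma> x") auto
          qed
        qed
        show "A (j, \<sigma>) \<union> {x\<in>space M. Bad \<sigma> x} \<in> events"
          using A[OF \<sigma>] Bad_meas by blast
      qed
      also have "\<dots> \<le> prob (A (j, \<sigma>)) + prob {x\<in>space M. Bad \<sigma> x}"
        using A[OF \<sigma>] Bad_meas by (rule measure_Un_le)
      finally have "t j / 2 \<le> prob (A (j, \<sigma>))"
        using big bad_prob t_pos[of j] by linarith
      then have "(j, \<sigma>) \<in> I"
        using \<sigma> j by (auto simp: I_def)
      from hits[OF this] bad_card
      have card_less: "card {l\<in>{..<n}. Bad \<sigma> (y l)} < card {l\<in>{..<n}. y l \<in> A (j, \<sigma>)}"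
        by simp
      have "\<not> {l\<in>{..<n}. y l \<in> A (j, \<sigma>)} \<subseteq> {l\<in>{..<n}. Bad \<sigma> (y l)}"
      proof
        assume "{l\<in>{..<n}. y l \<in> A (j, \<sigma>)} \<subseteq> {l\<in>{..<n}. Bad \<sigma> (y l)}"
        then have "card {l\<in>{..<n}. y l \<in> A (j, \<sigma>)} \<le> card {l\<in>{..<n}. Bad \<sigma> (y l)}"
          by (intro card_mono) auto
        with card_less show False
          by simp
      qed
      then obtain l where l: "l < n" "y l \<in> A (j, \<sigma>)" "\<not> Bad \<sigma> (y l)"
        by blast
      have "5 / 8 * u j < norm (avg \<sigma> j (y l))"
        using l by (simp add: A_def)
      moreover have "norm (avg \<sigma> j (y l)) \<le> norm (avg \<sigma> j (y l) - g (y l)) + norm (g (y l))"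
        using norm_triangle_sub[of "avg \<sigma> j (y l)" "g (y l)"] by (simp add: add.commute)
      moreover have "norm (g (y l)) \<le> u j / 8"
        using h_close[of "y l"] y[OF l(1)] zero l(1) by simp
      ultimately show False
        using avg_close[OF l(3)] u[of j] by linarith
    qed
    have int: "integrable M (\<lambda>x. norm (h x) powr p)"
    proof (rule integrable_const_bound[where B = "2 powr p"])
      show "AE x in M. norm (norm (h x) powr p) \<le> 2 powr p"
        using P AE_space[of M] by eventually_elim (use h_bound p in \<open>auto intro: powr_mono2\<close>)
    qed (use h in measurable)
    have int_S: "integrable M (indicator (S j) :: 'a \<Rightarrow> real)" for j
      using S[of j] by (simp add: emeasure_eq_measure)
    have int_sum: "integrable M (\<lambda>x. \<Sum>j\<le>J. (2 * u j) powr p * indicator (S j) x)"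
      using int_S by (intro Bochner_Integration.integrable_sum integrable_mult_right)
    have "expectation (\<lambda>x. norm (h x) powr p) \<le>
        expectation (\<lambda>x. (\<epsilon> / 2) powr p + (\<Sum>j\<le>J. (2 * u j) powr p * indicator (S j) x))"
    proof (rule integral_mono_AE[OF int])
      show "integrable M (\<lambda>x. (\<epsilon> / 2) powr p + (\<Sum>j\<le>J. (2 * u j) powr p * indicator (S j) x))"
        using int_sum by (rule Bochner_Integration.integrable_add[rotated]) simp
      show "AE x in M. norm (h x) powr p \<le>
          (\<epsilon> / 2) powr p + (\<Sum>j\<le>J. (2 * u j) powr p * indicator (S j) x)"
        using P AE_space[of M]
      proof eventually_elim
        case (elim x)
        then show ?case
          using dyadic_layer_bound[of p J \<epsilon> "norm (h x)"] h_bound[of x] p \<epsilon>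
          by (simp add: u_def S_def indicator_def of_bool_def)
      qed
    qed
    also have "\<dots> = (\<epsilon> / 2) powr p + (\<Sum>j\<le>J. (2 * u j) powr p * prob (S j))"
    proof -
      have "expectation (\<lambda>x. \<Sum>j\<le>J. (2 * u j) powr p * indicator (S j) x) =
          (\<Sum>j\<le>J. (2 * u j) powr p * prob (S j))"
        using int_S S by (subst Bochner_Integration.integral_sum)
          (auto intro!: integrable_mult_right sum.cong)
      then show ?thesis
        by (subst Bochner_Integration.integral_add[OF _ int_sum]) (simp_all add: prob_space)
    qed
    also have "(\<Sum>j\<le>J. (2 * u j) powr p * prob (S j)) \<le> (\<Sum>j\<le>J. (2 * u j) powr p * t j)"
      using S_small by (intro sum_mono mult_left_mono) auto
    also have "\<dots> = (\<Sum>j\<le>J. \<epsilon> powr p / (2 * (real J + 1)))"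
    proof (rule sum.cong)
      fix j
      have "(2 * u j) powr p \<noteq> 0"
        using u[of j] by simp
      then show "(2 * u j) powr p * t j = \<epsilon> powr p / (2 * (real J + 1))"
        unfolding t_def level_mass_def u_def[symmetric] by simp
    qed simp
    also have "\<dots> = \<epsilon> powr p / 2"
      by (simp add: field_simps)
    also have "(\<epsilon> / 2) powr p \<le> \<epsilon> powr p / 2"
    proof -
      have "(1 / 2 :: real) powr p \<le> (1 / 2) powr 1"
        using p by (intro powr_mono') auto
      then have "\<epsilon> powr p * (1 / 2) powr p \<le> \<epsilon> powr p * (1 / 2)"
        by (intro mult_left_mono) auto
      then show ?thesis
        using powr_mult[of \<epsilon> "1/2" p] by simp
    qed
    finally show ?thesis
      by simp
  qed
  with y show ?thesis
    by (intro exI[of _ y]) blast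
qed

section \<open>Choice of the levels and of the sparsities\<close>

text \<open>Sparsity of order \<open>4 ^ j * ln (1 / \<epsilon>)\<close> makes the exceptional sets on level \<open>j\<close> small. Multiplied by
the inverse level mass, of order \<open>ln (1 / \<epsilon>) * \<epsilon> powr (- p) * (1 / 2 ^ j) powr p\<close>, it stays bounded in \<open>j\<close>
precisely because \<open>p \<ge> 2\<close>. One logarithm comes from the sparsity and one from the number of levels.\<close>

lemma level_parameters:
  fixes p :: real
  assumes p: "2 \<le> p"
  shows "\<exists>C>0. \<forall>\<epsilon>>0. \<epsilon> < 1 / 2 \<longrightarrow> (\<exists>J s. 1 / 2 ^ J \<le> \<epsilon> / 2 \<and> \<epsilon> / 4 \<le> 1 / 2 ^ J \<and>
    (\<forall>j\<le>J. Suc j \<le> s j \<and>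
       8 * exp (- (real (s j) * (1 / 2 ^ j / 4)\<^sup>2 / 64)) \<le> level_mass p \<epsilon> J j / 8 \<and>
       2 * real (s j) \<le> C * (ln (1 / \<epsilon>))\<^sup>2 * \<epsilon> powr (- p) * level_mass p \<epsilon> J j / 8))"
proof -
  \<comment> \<open>Chosen so that \<open>ln (64 / level_mass p \<epsilon> J j) \<le> Q * ln (1 / \<epsilon>)\<close> for all levels.\<close>
  define Q where "Q = 264 + 3 * p"
  define C where "C = 4096 * 128 * Q * 2 powr p"
  have Q: "264 \<le> Q"
    using p by (simp add: Q_def)
  have "0 < C"
    using Q by (simp add: C_def)
  moreover have "\<exists>J s. 1 / 2 ^ J \<le> \<epsilon> / 2 \<and> \<epsilon> / 4 \<le> 1 / 2 ^ J \<and>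
    (\<forall>j\<le>J. Suc j \<le> s j \<and>
       8 * exp (- (real (s j) * (1 / 2 ^ j / 4)\<^sup>2 / 64)) \<le> level_mass p \<epsilon> J j / 8 \<and>
       2 * real (s j) \<le> C * (ln (1 / \<epsilon>))\<^sup>2 * \<epsilon> powr (- p) * level_mass p \<epsilon> J j / 8)"
    if \<epsilon>: "0 < \<epsilon>" "\<epsilon> < 1 / 2" for \<epsilon>
  proof -
    define L where "L = ln (1 / \<epsilon>)"
    have ln2: "1 / 2 \<le> ln (2 :: real)" "ln (2 :: real) \<le> 1"
      using ln2_ge_two_thirds ln_2_less_1 by linarith+
    have "ln 2 \<le> ln (1 / \<epsilon>)"
      using \<epsilon> by (subst ln_le_cancel_iff) (auto simp: field_simps)
    then have L: "1 / 2 \<le> L"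
      using ln2 by (simp add: L_def)
    define J where "J = nat \<lceil>log 2 (2 / \<epsilon>)\<rceil>"
    have log_pos: "0 \<le> log 2 (2 / \<epsilon>)"
      using \<epsilon> by (simp add: zero_le_log_cancel_iff field_simps)
    then have J: "log 2 (2 / \<epsilon>) \<le> real J" "real J \<le> log 2 (2 / \<epsilon>) + 1"
      unfolding J_def by linarith+
    have pow_J: "2 ^ J = 2 powr real J"
      by (simp add: powr_realpow)
    have "2 powr log 2 (2 / \<epsilon>) \<le> 2 powr real J" "2 powr real J \<le> 2 powr (log 2 (2 / \<epsilon>) + 1)"
      using J by (intro powr_mono; simp)+
    then have J_pow: "2 / \<epsilon> \<le> 2 ^ J" "2 ^ J \<le> 4 / \<epsilon>"
      using \<epsilon> unfolding pow_J by (simp_all add: powr_add)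
    then have J_level: "1 / 2 ^ J \<le> \<epsilon> / 2" "\<epsilon> / 4 \<le> 1 / 2 ^ J"
      using \<epsilon> by (simp_all add: field_simps)
    have "log 2 (2 / \<epsilon>) = 1 + L / ln 2"
      using \<epsilon> by (simp add: log_def L_def ln_div add_divide_distrib diff_divide_distrib)
    also have "L / ln 2 \<le> L / (1 / 2)"
      using ln2 L by (intro divide_left_mono) auto
    finally have J_le: "real J + 1 \<le> 8 * L"
      using J L by simp
    define s where "s j = nat \<lceil>1024 * Q * L * 4 ^ j\<rceil>" for j
    have "Suc j \<le> s j \<and>
       8 * exp (- (real (s j) * (1 / 2 ^ j / 4)\<^sup>2 / 64)) \<le> level_mass p \<epsilon> J j / 8 \<and>
       2 * real (s j) \<le> C * (ln (1 / \<epsilon>))\<^sup>2 * \<epsilon> powr (- p) * level_mass p \<epsilon> J j / 8" for j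
    proof (intro conjI)
      define m where "m = level_mass p \<epsilon> J j"
      define u :: real where "u = 1 / 2 ^ j"
      have u: "0 < u" "u \<le> 1" "1 / u\<^sup>2 = 4 ^ j"
        by (simp_all add: u_def power_divide flip: power_mult power_mult_distrib)
          (simp add: power_mult mult.commute[of j])
      have QL: "132 \<le> Q * L"
        using mult_mono[of 264 Q "1/2" L] Q L by simp
      have "1 * 1 \<le> 1024 * Q * L * 4 ^ j"
        using QL by (intro mult_mono') auto
      then have s: "1024 * Q * L * 4 ^ j \<le> real (s j)" "real (s j) \<le> 2 * (1024 * Q * L * 4 ^ j)"
        unfolding s_def by linarith+
      have "real (Suc j) \<le> 1 * 4 ^ j"
        using Bernoulli_inequality[of "3 :: real" j] by simp
      also have "1 * 4 ^ j \<le> 1024 * Q * L * 4 ^ j"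
        using QL by (intro mult_right_mono) auto
      finally show "Suc j \<le> s j"
        using s(1) by linarith
      have m_eq: "m = \<epsilon> powr p / (2 * (real J + 1) * (2 * u) powr p)"
        by (simp add: m_def level_mass_def u_def)
      have m_pos: "0 < m"
        using \<epsilon> u by (simp add: m_eq)
      have "ln (64 / m) = ln (128 * (real J + 1) * (2 * u) powr p * \<epsilon> powr (- p))"
        by (rule arg_cong[where f = ln]) (simp add: m_eq powr_minus divide_inverse)
      also have "\<dots> = ln 128 + ln (real J + 1) + p * ln (2 * u) + p * L"
        using \<epsilon> u by (simp add: ln_mult ln_powr L_def ln_div del: distrib_left_numeral distrib_right_numeral)
      also have "ln (128 :: real) \<le> 128"
        using ln_le_minus_one[of "128 :: real"] by simp
      also have "ln (real J + 1) \<le> 8 * L"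
        using ln_le_minus_one[of "real J + 1"] J_le by simp
      also have "p * ln (2 * u) \<le> p * (2 * L)"
      proof (intro mult_left_mono)
        have "ln (2 * u) \<le> ln 2"
          using u by (subst ln_le_cancel_iff) auto
        then show "ln (2 * u) \<le> 2 * L"
          using ln2 L by simp
      qed (use p in simp)
      finally have "ln (64 / m) \<le> 128 + 8 * L + p * (2 * L) + p * L"
        by simp
      also have "\<dots> \<le> Q * L"
        using L by (simp add: Q_def algebra_simps)
      also have "\<dots> = (1024 * Q * L * 4 ^ j) * u\<^sup>2 / 1024"
        using u by (simp flip: u(3))
      also have "\<dots> \<le> real (s j) * u\<^sup>2 / 1024"
        using s(1) by (intro divide_right_mono mult_right_mono) auto
      finally have "exp (- (real (s j) * u\<^sup>2 / 1024)) \<le> exp (- ln (64 / m))"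
        by simp
      also have "\<dots> = m / 64"
        using m_pos by (simp add: exp_minus)
      finally show "8 * exp (- (real (s j) * (1 / 2 ^ j / 4)\<^sup>2 / 64)) \<le> level_mass p \<epsilon> J j / 8"
        by (simp add: power_divide u_def m_def mult.commute)
      have "u powr p \<le> u powr 2"
        using u p by (intro powr_mono') auto
      then have "(2 * u) powr p \<le> 2 powr p * u\<^sup>2"
        using u by (simp add: powr_mult powr_numeral mult_left_mono)
      then have denom: "2 * (real J + 1) * (2 * u) powr p \<le> 2 * (8 * L) * (2 powr p * u\<^sup>2)"
        using J_le L by (intro mult_mono) auto
      have "2 * real (s j) \<le> 4096 * Q * L * 4 ^ j"
        using s(2) by (simp add: mult_ac)
      also have "\<dots> = C * L\<^sup>2 / (2 * (8 * L) * (2 powr p * u\<^sup>2)) / 8"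
        using u L by (simp add: C_def power2_eq_square flip: u(3))
      also have "\<dots> \<le> C * L\<^sup>2 / (2 * (real J + 1) * (2 * u) powr p) / 8"
        using denom \<open>0 < C\<close> u L by (intro divide_right_mono divide_left_mono) auto
      also have "\<dots> = C * L\<^sup>2 * \<epsilon> powr (- p) * m / 8"
        using \<epsilon> by (simp add: m_eq powr_minus)
      finally show "2 * real (s j) \<le> C * (ln (1 / \<epsilon>))\<^sup>2 * \<epsilon> powr (- p) * level_mass p \<epsilon> J j / 8"
        by (simp add: L_def m_def)
    qed
    with J_level show ?thesis
      by blast
  qed
  ultimately show ?thesis
    by blast
qed

section \<open>The cube as a probability space\<close>

lemma prob_space_unit_interval: "prob_space (restrict_space lborel {0..1::real})"
  by (rule prob_spaceI) (simp add: space_restrict_space emeasure_restrict_space)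

lemma prob_space_cube_measure: "prob_space (cube_measure d)"
  unfolding cube_measure_def by (intro prob_space_PiM prob_space_unit_interval)

lemma measurable_cube_coordinate [measurable]:
  "i < d \<Longrightarrow> (\<lambda>x. x i) \<in> borel_measurable (cube_measure d)"
proof -
  assume "i < d"
  then have "(\<lambda>x. x i) \<in> measurable (cube_measure d) (restrict_space lborel {0..1})"
    unfolding cube_measure_def by (intro measurable_component_singleton) auto
  moreover have "(\<lambda>u. u) \<in> borel_measurable (restrict_space lborel {0..1::real})"
    by (rule measurable_restrict_space1) simp
  ultimately have "(\<lambda>x. (\<lambda>u. u) (x i)) \<in> borel_measurable (cube_measure d)"
    by (rule measurable_compose)
  then show ?thesis
    by simp
qed

text \<open>The product \<open>\<sigma>\<close>-algebra of the cube comes from finitely many coordinates, continuity from the product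
topology on all of \<open>nat \<Rightarrow> real\<close>. They fit together because the remaining coordinates are constant on the cube.\<close>

lemma continuous_on_cube_measurable:
  fixes f :: "(nat \<Rightarrow> real) \<Rightarrow> complex"
  assumes "continuous_on (cube d) f"
  shows "f \<in> borel_measurable (cube_measure d)"
proof -
  have "(\<lambda>x. x) \<in> borel_measurable (cube_measure d)"
  proof (rule measurable_coordinatewise_then_product)
    fix i
    show "(\<lambda>x. x i) \<in> borel_measurable (cube_measure d)"
    proof (cases "i < d")
      case False
      then have "x i = undefined" if "x \<in> space (cube_measure d)" for x
        using that by (intro PiE_arb[of x "{..<d}"]) (auto simp: space_cube_measure cube_def)
      then show ?thesis
        by (subst measurable_cong[where g = "\<lambda>_. undefined"]) simp_all
    qed (rule measurable_cube_coordinate)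
  qed
  then have "(\<lambda>x. x) \<in> measurable (cube_measure d) (restrict_space borel (cube d))"
    by (intro measurable_restrict_space2) (auto simp: space_cube_measure)
  then show ?thesis
    using borel_measurable_continuous_on_restrict[OF assms] by (rule measurable_compose)
qed

lemma compact_cube: "compact (cube d)"
proof -
  have "cube d = PiE UNIV (\<lambda>i. if i < d then {0..1} else {undefined})"
  proof (intro set_eqI iffI)
    fix x :: "nat \<Rightarrow> real"
    assume "x \<in> cube d"
    then show "x \<in> PiE UNIV (\<lambda>i. if i < d then {0..1} else {undefined})"
      unfolding cube_def PiE_iff extensional_def by simp
  next
    fix x :: "nat \<Rightarrow> real"
    assume x: "x \<in> PiE UNIV (\<lambda>i. if i < d then {0..1} else {undefined})"
    have "x i \<in> {0..1}" if "i < d" for i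
      using PiE_mem[OF x, of i] that by simp
    moreover have "x i = undefined" if "\<not> i < d" for i
      using PiE_mem[OF x, of i] that by simp
    ultimately show "x \<in> cube d"
      unfolding cube_def PiE_iff extensional_def by blast
  qed
  moreover have "compactin (product_topology (\<lambda>i. euclidean) UNIV)
      (PiE UNIV (\<lambda>i. if i < d then {0..1::real} else {undefined}))"
    unfolding compactin_PiE by auto
  ultimately show ?thesis
    by (simp add: euclidean_product_topology)
qed

lemma continuous_on_cube_bounded:
  fixes f :: "(nat \<Rightarrow> real) \<Rightarrow> complex"
  assumes "continuous_on (cube d) f"
  obtains B where "0 < B" "\<And>x. x \<in> cube d \<Longrightarrow> norm (f x) \<le> B"
proof -
  have "bounded (f ` cube d)"
    using assms compact_cube by (intro compact_imp_bounded compact_continuous_image)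
  then show ?thesis
    using that unfolding bounded_pos by auto
qed

text \<open>Membership of the cube is left out, so that this is a mere condition on points of the cube. A
function on the cube need not be periodic, so its Fourier series can represent it only here.\<close>

definition open_cube :: "nat \<Rightarrow> (nat \<Rightarrow> real) \<Rightarrow> bool" where
  "open_cube d x \<longleftrightarrow> (\<forall>i<d. x i \<in> {0<..<1})"

lemma AE_open_cube: "AE x in cube_measure d. open_cube d x"
proof -
  have "AE x in cube_measure d. x i \<in> {0<..<1}" if "i < d" for i
    unfolding cube_measure_def
  proof (rule AE_PiM_component[where P = "\<lambda>u. u \<in> {0<..<1}"])
    have "AE x in lborel. x \<noteq> 0 \<and> x \<noteq> (1::real)"
      using AE_lborel_singleton[of "0::real"] AE_lborel_singleton[of "1::real"] by eventually_elim auto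
    then show "AE x in restrict_space lborel {0..1::real}. x \<in> {0<..<1}"
      by (subst AE_restrict_space_iff) (simp, erule eventually_mono, auto)
  qed (use that prob_space_unit_interval in auto)
  then show ?thesis
    unfolding open_cube_def by (simp add: AE_all_countable)
qed

section \<open>Exponentials and their integrals\<close>

definition wave :: "nat \<Rightarrow> (nat \<Rightarrow> int) \<Rightarrow> (nat \<Rightarrow> real) \<Rightarrow> complex" where
  "wave d k x = exp (2 * of_real pi * \<i> * of_real (\<Sum>i<d. of_int (k i) * x i))"

lemma fourier_coeff_eq: "fourier_coeff d f k = (LINT x|cube_measure d. f x * wave d (\<lambda>i. - k i) x)"
  by (simp add: fourier_coeff_def wave_def sum_negf)

lemma wave_eq_cis: "wave d k x = cis (2 * pi * (\<Sum>i<d. of_int (k i) * x i))"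
  by (simp add: wave_def cis_conv_exp mult_ac)

lemma norm_wave [simp]: "norm (wave d k x) = 1"
  by (simp add: wave_eq_cis)

lemma wave_add: "wave d (\<lambda>i. k i + l i) x = wave d k x * wave d l x"
  by (simp add: wave_eq_cis cis_mult algebra_simps sum.distrib)

lemma wave_cong: "(\<And>i. i < d \<Longrightarrow> k i = l i) \<Longrightarrow> wave d k x = wave d l x"
  by (simp add: wave_def)

lemma cnj_wave: "cnj (wave d k x) = wave d (\<lambda>i. - k i) x"
  by (simp add: wave_eq_cis cis_cnj sum_negf)

lemma wave_diff_arg: "wave d k (\<lambda>i. x i - t i) = wave d k x * wave d (\<lambda>i. - k i) t"
  by (simp add: wave_eq_cis cis_mult algebra_simps sum_subtractf sum_negf)

lemma measurable_wave [measurable]: "wave d k \<in> borel_measurable (cube_measure d)"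
  unfolding wave_def by measurable

lemma integral_exp_unit_interval:
  "(LINT x|restrict_space lborel {0..1::real}. cis (2 * pi * of_int m * x)) = of_bool (m = 0)"
proof (cases "m = 0")
  case True
  interpret prob_space "restrict_space lborel {0..1::real}"
    by (rule prob_space_unit_interval)
  show ?thesis
    using True prob_space by simp
next
  case False
  define a :: complex where "a = of_real (2 * pi * of_int m) * \<i>"
  have a: "a \<noteq> 0"
    using False by (simp add: a_def)
  have cis_eq: "cis (2 * pi * of_int m * x) = exp (a * of_real x)" for x :: real
    by (simp add: a_def cis_conv_exp mult_ac)
  have "(LINT x|restrict_space lborel {0..1::real}. exp (a * of_real x)) =
      integral\<^sup>L lborel (\<lambda>x. indicator {0..1::real} x *\<^sub>R exp (a * of_real x))"
    by (simp add: integral_restrict_space)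
  also have "\<dots> = exp (a * of_real 1) / a - exp (a * of_real 0) / a"
  proof (rule integral_FTC_atLeastAtMost)
    fix x :: real
    have "((\<lambda>z. exp (a * z) / a) has_field_derivative exp (a * of_real x)) (at (of_real x))"
      using a by (auto intro!: derivative_eq_intros)
    then show "((\<lambda>x. exp (a * of_real x) / a) has_vector_derivative exp (a * of_real x)) (at x within {0..1})"
      by (rule has_vector_derivative_real_field)
  qed (auto intro!: continuous_intros)
  also have "exp (a * of_real 1) = 1"
    by (simp add: a_def exp_eq_1)
  finally show ?thesis
    using False by (simp add: cis_eq)
qed

lemma integral_wave: "(LINT x|cube_measure d. wave d k x) = of_bool (\<forall>i<d. k i = 0)"
proof -
  interpret product_sigma_finite "\<lambda>i::nat. restrict_space lborel {0..1::real}"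
    by (simp add: product_sigma_finite_def prob_space_imp_sigma_finite prob_space_unit_interval)
  interpret U: prob_space "restrict_space lborel {0..1::real}"
    by (rule prob_space_unit_interval)
  have "wave d k x = (\<Prod>i<d. cis (2 * pi * of_int (k i) * x i))" for x
    by (simp add: wave_def cis_conv_exp exp_sum sum_distrib_left mult_ac)
  then have "(LINT x|cube_measure d. wave d k x) =
      (\<Prod>i<d. LINT x|restrict_space lborel {0..1::real}. cis (2 * pi * of_int (k i) * x))"
    unfolding cube_measure_def
    by (simp, intro product_integral_prod) (auto intro!: U.integrable_const_bound[where B = 1] measurable_restrict_space1 simp: cis_conv_exp)
  also have "\<dots> = of_bool (\<forall>i<d. k i = 0)"
    by (auto simp: integral_exp_unit_interval)
  finally show ?thesis .
qed

section \<open>Uniformly small tails of the Fourier series\<close>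

text \<open>Neighbourhoods in the product topology, restricted to the cube, are governed by the first \<open>d\<close>
coordinates, as the others are constant there.\<close>

lemma continuous_on_cube_nearby:
  fixes f :: "(nat \<Rightarrow> real) \<Rightarrow> complex"
  assumes f: "continuous_on (cube d) f" and x: "x \<in> cube d" and e: "0 < e"
  obtains \<delta> where "0 < \<delta>" "\<And>t. t \<in> cube d \<Longrightarrow> (\<And>i. i < d \<Longrightarrow> \<bar>t i - x i\<bar> < \<delta>) \<Longrightarrow> norm (f t - f x) < e"
proof -
  have "\<exists>n. \<forall>t\<in>cube d. (\<forall>i<d. \<bar>t i - x i\<bar> < inverse (real (Suc n))) \<longrightarrow> norm (f t - f x) < e"
  proof (rule ccontr)
    assume "\<not> ?thesis"
    then have "\<forall>n. \<exists>t. t \<in> cube d \<and> (\<forall>i<d. \<bar>t i - x i\<bar> < inverse (real (Suc n))) \<and> e \<le> norm (f t - f x)"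
      by (auto simp: not_less)
    then obtain t where t: "\<And>n. t n \<in> cube d"
      "\<And>n i. i < d \<Longrightarrow> \<bar>t n i - x i\<bar> < inverse (real (Suc n))"
      "\<And>n. e \<le> norm (f (t n) - f x)"
      by metis
    have "(\<lambda>n. t n i) \<longlonglongrightarrow> x i" for i
    proof (cases "i < d")
      case True
      have "(\<lambda>n. t n i - x i) \<longlonglongrightarrow> 0"
        by (rule tendsto_0_le[OF LIMSEQ_inverse_real_of_nat, where K = 1])
           (use t(2)[OF True] in \<open>auto simp: less_imp_le\<close>)
      then show ?thesis
        by (simp add: LIM_zero_iff)
    next
      case False
      then have "t n i = x i" for n
        using t(1)[of n] x by (auto simp: cube_def PiE_iff extensional_def)
      then show ?thesis
        by simp
    qed
    then have "limitin (product_topology (\<lambda>i. euclidean) UNIV) t x sequentially"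
      by (simp add: limitin_componentwise)
    then have "t \<longlonglongrightarrow> x"
      by (simp add: euclidean_product_topology)
    then have "(\<lambda>n. f (t n)) \<longlonglongrightarrow> f x"
      using f x t(1) by (simp add: continuous_on_sequentially o_def)
    then have "(\<lambda>n. norm (f (t n) - f x)) \<longlonglongrightarrow> 0"
      by (simp add: LIM_zero_iff tendsto_norm_zero)
    then have "\<forall>\<^sub>F n in sequentially. norm (f (t n) - f x) < e"
      using e by (rule order_tendstoD)
    then show False
      using t(3) by (auto simp: eventually_sequentially not_less[symmetric])
  qed
  then obtain n where n: "\<forall>t\<in>cube d. (\<forall>i<d. \<bar>t i - x i\<bar> < inverse (real (Suc n))) \<longrightarrow> norm (f t - f x) < e"
    by blast
  show thesis
    by (rule that[of "inverse (real (Suc n))"]) (use n in auto)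
qed

definition fejer_box :: "nat \<Rightarrow> nat \<Rightarrow> (nat \<Rightarrow> int) set" where
  "fejer_box d n = {..<d} \<rightarrow>\<^sub>E {0..<int n}"

definition freq_diff :: "nat \<Rightarrow> (nat \<Rightarrow> int) \<Rightarrow> (nat \<Rightarrow> int) \<Rightarrow> nat \<Rightarrow> int" where
  "freq_diff d j l = (\<lambda>i\<in>{..<d}. j i - l i)"

text \<open>The product of the one-dimensional Fejer kernels: summing over a box before squaring yields the
product without ever writing it as one, and exhibits both positivity and the Fourier expansion.\<close>

definition fejer :: "nat \<Rightarrow> nat \<Rightarrow> (nat \<Rightarrow> real) \<Rightarrow> real" where
  "fejer d n z = (norm (\<Sum>j\<in>fejer_box d n. wave d j z))\<^sup>2 / real n ^ d"

text \<open>The Fourier coefficients of the kernel.\<close>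

definition fejer_weight :: "nat \<Rightarrow> nat \<Rightarrow> (nat \<Rightarrow> int) \<Rightarrow> real" where
  "fejer_weight d n k =
     real (card {(j, l) \<in> fejer_box d n \<times> fejer_box d n. freq_diff d j l = k}) / real n ^ d"

lemma finite_fejer_box: "finite (fejer_box d n)"
  unfolding fejer_box_def by (intro finite_PiE) auto

lemma freq_diff_in_freqs: "freq_diff d j l \<in> freqs d"
  by (simp add: freq_diff_def freqs_def)

lemma fejer_nonneg: "0 \<le> fejer d n z"
  by (simp add: fejer_def)

lemma fejer_expansion:
  "complex_of_real (fejer d n z) =
     (\<Sum>(j, l)\<in>fejer_box d n \<times> fejer_box d n. wave d (freq_diff d j l) z) / of_nat n ^ d"
proof -
  have diff: "wave d j z * cnj (wave d l z) = wave d (freq_diff d j l) z" for j l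
    unfolding cnj_wave wave_add[symmetric] by (rule wave_cong) (simp add: freq_diff_def)
  have "complex_of_real (fejer d n z) =
      (\<Sum>j\<in>fejer_box d n. wave d j z) * cnj (\<Sum>j\<in>fejer_box d n. wave d j z) / of_nat n ^ d"
    unfolding fejer_def of_real_divide complex_norm_square by simp
  also have "(\<Sum>j\<in>fejer_box d n. wave d j z) * cnj (\<Sum>j\<in>fejer_box d n. wave d j z) =
      (\<Sum>j\<in>fejer_box d n. \<Sum>l\<in>fejer_box d n. wave d (freq_diff d j l) z)"
    by (simp only: cnj_sum sum_product diff)
  finally show ?thesis
    by (simp add: sum.cartesian_product)
qed

lemma fejer_mean_expansion:
  assumes "f \<in> borel_measurable (cube_measure d)"
    and B: "\<And>t. t \<in> cube d \<Longrightarrow> norm (f t) \<le> B"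
  shows "integrable (cube_measure d) (\<lambda>t. f t * of_real (fejer d n (\<lambda>i. x i - t i)))"
    and "(LINT t|cube_measure d. f t * of_real (fejer d n (\<lambda>i. x i - t i))) =
      (\<Sum>(j, l)\<in>fejer_box d n \<times> fejer_box d n.
         fourier_coeff d f (freq_diff d j l) * wave d (freq_diff d j l) x) / of_nat n ^ d"
proof -
  interpret prob_space "cube_measure d"
    by (rule prob_space_cube_measure)
  define D where "D = fejer_box d n \<times> fejer_box d n"
  define k where "k = (\<lambda>(j, l). freq_diff d j l)"
  have int: "integrable (cube_measure d) (\<lambda>t. f t * wave d (\<lambda>i. - k p i) t)" for p
  proof (rule integrable_const_bound[where B = B])
    show "AE t in cube_measure d. norm (f t * wave d (\<lambda>i. - k p i) t) \<le> B"
      using AE_space[of "cube_measure d"]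
      by eventually_elim (simp add: norm_mult space_cube_measure B)
  qed (use assms(1) in measurable)
  have eq: "(\<lambda>t. f t * of_real (fejer d n (\<lambda>i. x i - t i))) =
      (\<lambda>t. (\<Sum>p\<in>D. (f t * wave d (\<lambda>i. - k p i) t) * wave d (k p) x) / of_nat n ^ d)"
    by (rule ext) (simp add: fejer_expansion wave_diff_arg D_def k_def sum_distrib_left mult_ac case_prod_unfold)
  have int': "integrable (cube_measure d) (\<lambda>t. \<Sum>p\<in>D. (f t * wave d (\<lambda>i. - k p i) t) * wave d (k p) x)"
    using int by (intro Bochner_Integration.integrable_sum integrable_mult_left)
  show "integrable (cube_measure d) (\<lambda>t. f t * of_real (fejer d n (\<lambda>i. x i - t i)))"
    unfolding eq using int' by (rule integrable_divide_zero)
  have "(LINT t|cube_measure d. (\<Sum>p\<in>D. (f t * wave d (\<lambda>i. - k p i) t) * wave d (k p) x)) =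
      (\<Sum>p\<in>D. (LINT t|cube_measure d. f t * wave d (\<lambda>i. - k p i) t) * wave d (k p) x)"
    using int by (subst Bochner_Integration.integral_sum) (auto intro: integrable_mult_left)
  then show "(LINT t|cube_measure d. f t * of_real (fejer d n (\<lambda>i. x i - t i))) =
      (\<Sum>(j, l)\<in>fejer_box d n \<times> fejer_box d n.
         fourier_coeff d f (freq_diff d j l) * wave d (freq_diff d j l) x) / of_nat n ^ d"
    unfolding eq by (simp add: D_def k_def fourier_coeff_eq case_prod_unfold)
qed

lemma fejer_mean_regroup:
  assumes "finite D"
    and "\<And>j l. j \<in> fejer_box d n \<Longrightarrow> l \<in> fejer_box d n \<Longrightarrow> freq_diff d j l \<in> D"
  shows "(\<Sum>(j, l)\<in>fejer_box d n \<times> fejer_box d n. G (freq_diff d j l)) / of_nat n ^ d =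
    (\<Sum>k\<in>D. of_real (fejer_weight d n k) * (G k :: complex))"
proof -
  let ?P = "fejer_box d n \<times> fejer_box d n"
  have "(\<Sum>p\<in>?P. G (freq_diff d (fst p) (snd p))) =
      (\<Sum>k\<in>D. \<Sum>p | p \<in> ?P \<and> freq_diff d (fst p) (snd p) = k. G (freq_diff d (fst p) (snd p)))"
    using assms finite_fejer_box by (intro sum.group[symmetric]) auto
  also have "\<dots> = (\<Sum>k\<in>D. of_nat (card {(j, l) \<in> ?P. freq_diff d j l = k}) * G k)"
  proof (rule sum.cong)
    fix k
    have "{(j, l) \<in> ?P. freq_diff d j l = k} = {p. p \<in> ?P \<and> freq_diff d (fst p) (snd p) = k}"
      by auto
    then show "(\<Sum>p | p \<in> ?P \<and> freq_diff d (fst p) (snd p) = k. G (freq_diff d (fst p) (snd p)))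
        = of_nat (card {(j, l) \<in> ?P. freq_diff d j l = k}) * G k"
      by simp
  qed simp
  finally show ?thesis
    by (simp add: case_prod_unfold fejer_weight_def sum_divide_distrib)
qed

lemma fourier_coeff_wave:
  "fourier_coeff d (wave d m) k = of_bool (\<forall>i<d. m i = k i)"
proof -
  have "(\<lambda>x. wave d m x * wave d (\<lambda>i. - k i) x) = wave d (\<lambda>i. m i + - k i)"
    by (simp add: wave_add[symmetric] fun_eq_iff)
  then show ?thesis
    by (simp add: fourier_coeff_eq integral_wave)
qed

lemma fejer_mean_wave:
  assumes m: "m \<in> freqs d"
  shows "(LINT t|cube_measure d. wave d m t * of_real (fejer d n (\<lambda>i. x i - t i))) =
    of_real (fejer_weight d n m) * wave d m x"
proof -
  define D where "D = insert m ((\<lambda>(j, l). freq_diff d j l) ` (fejer_box d n \<times> fejer_box d n))"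
  have D: "finite D" "D \<subseteq> freqs d"
    using m freq_diff_in_freqs finite_fejer_box by (auto simp: D_def)
  have coeff: "fourier_coeff d (wave d m) k = of_bool (m = k)" if "k \<in> freqs d" for k
  proof -
    have "m = k" if "\<forall>i<d. m i = k i"
      using m \<open>k \<in> freqs d\<close> that unfolding freqs_def by (intro PiE_ext[of m _ _ k]) auto
    then show ?thesis
      by (auto simp: fourier_coeff_wave)
  qed
  have "(LINT t|cube_measure d. wave d m t * of_real (fejer d n (\<lambda>i. x i - t i))) =
      (\<Sum>k\<in>D. of_real (fejer_weight d n k) * (fourier_coeff d (wave d m) k * wave d k x))"
    using D
    by (subst fejer_mean_expansion(2)[where B = 1], simp, simp, subst fejer_mean_regroup[where D = D])
       (auto simp: D_def)
  also have "\<dots> = (\<Sum>k\<in>D. if m = k then of_real (fejer_weight d n k) * wave d k x else 0)"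
    using D coeff by (intro sum.cong) auto
  also have "\<dots> = of_real (fejer_weight d n m) * wave d m x"
    using D by (simp add: D_def)
  finally show ?thesis .
qed

text \<open>For a given difference \<open>k\<close>, the second frequency ranges over a box with sides \<open>n - \<bar>k i\<bar>\<close> and
determines the first one.\<close>

lemma fejer_weight_eq:
  assumes k: "k \<in> freqs d"
  shows "fejer_weight d n k = (\<Prod>i<d. real (nat (int n - \<bar>k i\<bar>)) / real n)"
proof -
  define L where "L = PiE {..<d} (\<lambda>i. {max 0 (- k i)..<min (int n) (int n - k i)})"
  have "bij_betw (\<lambda>l. (\<lambda>i\<in>{..<d}. l i + k i, l)) L
      {(j, l) \<in> fejer_box d n \<times> fejer_box d n. freq_diff d j l = k}"
  proof (rule bij_betwI[where g = snd])
    show "(\<lambda>l. (\<lambda>i\<in>{..<d}. l i + k i, l)) \<in> L \<rightarrow> {(j, l) \<in> fejer_box d n \<times> fejer_box d n. freq_diff d j l = k}"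
    proof
      fix l assume l: "l \<in> L"
      have bounds: "max 0 (- k i) \<le> l i" "l i < min (int n) (int n - k i)" if "i < d" for i
        using PiE_mem[OF l[unfolded L_def], of i] that by auto
      have "l \<in> fejer_box d n" "(\<lambda>i\<in>{..<d}. l i + k i) \<in> fejer_box d n"
        using l bounds by (force simp: L_def fejer_box_def PiE_iff)+
      moreover have "freq_diff d (\<lambda>i\<in>{..<d}. l i + k i) l = k"
        using k by (auto simp: freq_diff_def freqs_def PiE_iff extensional_def fun_eq_iff)
      ultimately show "(\<lambda>i\<in>{..<d}. l i + k i, l) \<in> {(j, l) \<in> fejer_box d n \<times> fejer_box d n. freq_diff d j l = k}"
        by simp
    qed
    show "snd \<in> {(j, l) \<in> fejer_box d n \<times> fejer_box d n. freq_diff d j l = k} \<rightarrow> L"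
      by (fastforce simp: fejer_box_def L_def PiE_iff freq_diff_def)
    show "(\<lambda>i\<in>{..<d}. snd p i + k i, snd p) = p"
      if p_in: "p \<in> {(j, l) \<in> fejer_box d n \<times> fejer_box d n. freq_diff d j l = k}" for p
    proof -
      obtain j l where p: "p = (j, l)" "j \<in> fejer_box d n" "freq_diff d j l = k"
        using p_in by (cases p) auto
      have "l i + k i = j i" if "i < d" for i
        using that unfolding p(3)[symmetric] by (simp add: freq_diff_def)
      moreover have "j \<in> extensional {..<d}"
        using p(2) by (simp add: fejer_box_def PiE_iff)
      ultimately have "(\<lambda>i\<in>{..<d}. l i + k i) = j"
        by (intro extensionalityI[of _ "{..<d}"]) auto
      then show ?thesis
        by (simp add: p)
    qed
  qed simp
  then have "card {(j, l) \<in> fejer_box d n \<times> fejer_box d n. freq_diff d j l = k} = card L"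
    by (simp add: bij_betw_same_card)
  also have "\<dots> = (\<Prod>i<d. nat (int n - \<bar>k i\<bar>))"
    unfolding L_def by (subst card_PiE) (auto intro!: prod.cong arg_cong[where f = nat])
  finally show ?thesis
    by (simp add: fejer_weight_def prod_dividef)
qed

lemma fejer_weight_bounds:
  assumes "k \<in> freqs d"
  shows "0 \<le> fejer_weight d n k" "fejer_weight d n k \<le> 1"
  unfolding fejer_weight_eq[OF assms]
  by (auto intro!: prod_nonneg prod_le_1 simp: divide_le_eq)

lemma fejer_weight_tendsto:
  assumes "k \<in> freqs d"
  shows "(\<lambda>n. fejer_weight d n k) \<longlonglongrightarrow> 1"
proof -
  have "(\<lambda>n. real (nat (int n - \<bar>a\<bar>)) / real n) \<longlonglongrightarrow> 1" for a :: int
  proof -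
    have "(\<lambda>n. 1 - real_of_int \<bar>a\<bar> / real n) \<longlonglongrightarrow> 1 - 0"
      by (intro tendsto_intros lim_const_over_n)
    moreover have "\<forall>\<^sub>F n in sequentially. 1 - real_of_int \<bar>a\<bar> / real n = real (nat (int n - \<bar>a\<bar>)) / real n"
      using eventually_gt_at_top[of "nat \<bar>a\<bar>"]
      by eventually_elim (simp add: field_simps of_nat_nat nat_less_iff)
    ultimately show ?thesis
      by (simp add: tendsto_cong)
  qed
  then have "(\<lambda>n. \<Prod>i<d. real (nat (int n - \<bar>k i\<bar>)) / real n) \<longlonglongrightarrow> (\<Prod>i<d. 1)"
    by (intro tendsto_prod)
  then show ?thesis
    by (simp add: fejer_weight_eq[OF assms])
qed

lemma cos_le_cos_of_far:
  fixes r s :: real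
  assumes "0 \<le> r" "r \<le> \<bar>s\<bar>" "\<bar>s\<bar> \<le> 1 - r"
  shows "cos (2 * pi * s) \<le> cos (2 * pi * r)"
proof -
  have main: "cos (2 * pi * a) \<le> cos (2 * pi * r)" if "r \<le> a" "a \<le> 1 / 2" for a
    using that assms(1) by (intro cos_monotone_0_pi_le) auto
  have "cos (2 * pi * s) = cos (2 * pi * \<bar>s\<bar>)"
    by (cases "0 \<le> s") auto
  moreover have "cos (2 * pi * \<bar>s\<bar>) = cos (2 * pi * (1 - \<bar>s\<bar>))"
    by (simp add: right_diff_distrib cos_diff)
  ultimately show ?thesis
    using main[of "\<bar>s\<bar>"] main[of "1 - \<bar>s\<bar>"] assms by (cases "\<bar>s\<bar> \<le> 1 / 2") auto
qed

text \<open>At an interior point, coordinates differing from those of \<open>x\<close> by at least \<open>r\<close> also differ by at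
least \<open>r\<close> modulo \<open>1\<close>, so the test function \<open>1 - cos (2 * pi * (t i - x i))\<close> is bounded below there. Near \<open>x\<close>
continuity suffices, elsewhere a multiple of the test functions dominates the bounded function \<open>f\<close>.\<close>

lemma korovkin_bound:
  fixes f :: "(nat \<Rightarrow> real) \<Rightarrow> complex"
  assumes f: "continuous_on (cube d) f" and x: "x \<in> cube d" "open_cube d x" and e: "0 < e"
  obtains C where "0 \<le> C"
    "\<And>t. t \<in> cube d \<Longrightarrow> norm (f t - f x) \<le> e + C * (\<Sum>i<d. 1 - cos (2 * pi * (t i - x i)))"
proof -
  obtain \<delta> where \<delta>: "0 < \<delta>"
    "\<And>t. t \<in> cube d \<Longrightarrow> (\<And>i. i < d \<Longrightarrow> \<bar>t i - x i\<bar> < \<delta>) \<Longrightarrow> norm (f t - f x) < e"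
    using continuous_on_cube_nearby[OF f x(1) e] by blast
  obtain B where B: "0 < B" "\<And>t. t \<in> cube d \<Longrightarrow> norm (f t) \<le> B"
    using continuous_on_cube_bounded[OF f] by blast
  define R where "R = {\<delta>, 1 / 2} \<union> x ` {..<d} \<union> (\<lambda>i. 1 - x i) ` {..<d}"
  define r where "r = Min R"
  have R: "finite R" "R \<noteq> {}"
    by (auto simp: R_def)
  have r_le: "r \<le> \<delta>" "r \<le> 1 / 2" "\<And>i. i < d \<Longrightarrow> r \<le> x i" "\<And>i. i < d \<Longrightarrow> r \<le> 1 - x i"
    unfolding r_def by (intro Min_le R(1), simp add: R_def)+
  have r_pos: "0 < r"
    using x(2) \<delta>(1) R by (auto simp: r_def R_def open_cube_def)
  define c where "c = 1 - cos (2 * pi * r)"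
  have "cos (2 * pi * r) < cos 0"
    using r_pos r_le by (intro cos_monotone_0_pi) auto
  then have c: "0 < c"
    by (simp add: c_def)
  define C where "C = 2 * B / c"
  have "norm (f t - f x) \<le> e + C * (\<Sum>i<d. 1 - cos (2 * pi * (t i - x i)))" if t: "t \<in> cube d" for t
  proof (cases "\<forall>i<d. \<bar>t i - x i\<bar> < r")
    case True
    then have "norm (f t - f x) < e"
      using r_le(1) by (intro \<delta>(2)[OF t]) force
    moreover have "0 \<le> C * (\<Sum>i<d. 1 - cos (2 * pi * (t i - x i)))"
      using B c by (intro mult_nonneg_nonneg sum_nonneg) (auto simp: C_def)
    ultimately show ?thesis
      by linarith
  next
    case False
    then obtain i where i: "i < d" "r \<le> \<bar>t i - x i\<bar>"
      by (auto simp: not_less)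
    have "0 \<le> t i" "t i \<le> 1"
      using t i(1) by (auto simp: cube_def PiE_iff)
    then have "\<bar>t i - x i\<bar> \<le> 1 - r"
      using r_le(3,4)[OF i(1)] by linarith
    then have "c \<le> 1 - cos (2 * pi * (t i - x i))"
      using cos_le_cos_of_far[of r "t i - x i"] i r_pos by (simp add: c_def)
    also have "\<dots> \<le> (\<Sum>i<d. 1 - cos (2 * pi * (t i - x i)))"
      using i(1) by (intro member_le_sum[of i "{..<d}" "\<lambda>i. 1 - cos (2 * pi * (t i - x i))"]) auto
    finally have "C * c \<le> C * (\<Sum>i<d. 1 - cos (2 * pi * (t i - x i)))"
      using B c by (intro mult_left_mono) (auto simp: C_def)
    moreover have "norm (f t - f x) \<le> C * c"
      using norm_triangle_ineq4[of "f t" "f x"] B(2)[OF t] B(2)[OF x(1)] c by (simp add: C_def)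
    ultimately show ?thesis
      using e by linarith
  qed
  moreover have "0 \<le> C"
    using B c by (simp add: C_def)
  ultimately show thesis
    using that by blast
qed

lemma fejer_moments:
  shows "integrable (cube_measure d) (\<lambda>t. fejer d n (\<lambda>i. x i - t i))"
    and "0 < n \<Longrightarrow> (LINT t|cube_measure d. fejer d n (\<lambda>i. x i - t i)) = 1"
    and "i < d \<Longrightarrow> integrable (cube_measure d) (\<lambda>t. cos (2 * pi * (t i - x i)) * fejer d n (\<lambda>i. x i - t i))"
    and "i < d \<Longrightarrow> (LINT t|cube_measure d. cos (2 * pi * (t i - x i)) * fejer d n (\<lambda>i. x i - t i)) =
      fejer_weight d n (\<lambda>j\<in>{..<d}. of_bool (j = i))"
proof -
  let ?M = "cube_measure d"
  define F where "F t = fejer d n (\<lambda>i. x i - t i)" for t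
  define z :: "nat \<Rightarrow> int" where "z = (\<lambda>i\<in>{..<d}. 0)"
  define u :: "nat \<Rightarrow> nat \<Rightarrow> int" where "u i = (\<lambda>j\<in>{..<d}. of_bool (j = i))" for i
  have freqs: "z \<in> freqs d" "u i \<in> freqs d" for i
    by (simp_all add: z_def u_def freqs_def)
  have wave_int: "integrable ?M (\<lambda>t. wave d m t * of_real (F t))" for m
    unfolding F_def by (rule fejer_mean_expansion(1)[where B = 1]) auto
  have wave_z: "wave d z t = 1" for t
    by (simp add: wave_eq_cis z_def)
  have int_complex: "integrable ?M (\<lambda>t. complex_of_real (F t))"
    using wave_int[of z] by (simp add: wave_z)
  then have "integrable ?M F"
    using integrable_Re by fastforce
  then show int: "integrable ?M (\<lambda>t. fejer d n (\<lambda>i. x i - t i))"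
    by (simp add: F_def[abs_def])
  show "(LINT t|?M. fejer d n (\<lambda>i. x i - t i)) = 1" if "0 < n"
  proof -
    have "fejer_weight d n z = 1"
      unfolding fejer_weight_eq[OF freqs(1)] using that by (simp add: z_def)
    then have "complex_of_real (LINT t|?M. F t) = 1"
      using fejer_mean_wave[OF freqs(1), of n x] by (simp add: wave_z F_def)
    then show ?thesis
      by (simp add: F_def)
  qed
  have cos_eq: "Re (wave d (u i) t * of_real (F t) * cnj (wave d (u i) x)) =
      cos (2 * pi * (t i - x i)) * F t" if "i < d" for i t
  proof -
    have "wave d (u i) s = cis (2 * pi * s i)" for s
      using that by (simp add: wave_eq_cis u_def if_distrib cong: if_cong)
    then have eq: "wave d (u i) t * of_real (F t) * cnj (wave d (u i) x) =
        of_real (F t) * cis (2 * pi * (t i - x i))"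
      by (simp add: cis_cnj cis_mult right_diff_distrib mult_ac)
    show ?thesis
      unfolding eq by simp
  qed
  have int_i: "integrable ?M (\<lambda>t. wave d (u i) t * of_real (F t) * cnj (wave d (u i) x))" for i
    using wave_int[of "u i"] by (intro integrable_mult_left)
  show "integrable ?M (\<lambda>t. cos (2 * pi * (t i - x i)) * fejer d n (\<lambda>i. x i - t i))" if "i < d"
    using integrable_Re[OF int_i[of i]] unfolding cos_eq[OF that] unfolding F_def .
  show "(LINT t|?M. cos (2 * pi * (t i - x i)) * fejer d n (\<lambda>i. x i - t i)) =
      fejer_weight d n (\<lambda>j\<in>{..<d}. of_bool (j = i))" if "i < d"
  proof -
    have "(LINT t|?M. cos (2 * pi * (t i - x i)) * F t) =
        Re (LINT t|?M. wave d (u i) t * of_real (F t) * cnj (wave d (u i) x))"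
      using integral_Re[OF int_i[of i]] unfolding cos_eq[OF that] .
    also have "(LINT t|?M. wave d (u i) t * of_real (F t) * cnj (wave d (u i) x)) =
        of_real (fejer_weight d n (u i)) * (wave d (u i) x * cnj (wave d (u i) x))"
      using fejer_mean_wave[OF freqs(2)[of i], of n x] by (simp add: F_def)
    also have "\<dots> = of_real (fejer_weight d n (u i))"
      by (simp add: complex_norm_square[symmetric])
    finally show ?thesis
      by (simp add: F_def u_def)
  qed
qed

text \<open>Korovkin's argument: the kernel is positive with integral \<open>1\<close>, so the previous bound may be integrated
against it, and the test functions then contribute \<open>1\<close> minus the first Fourier coefficients of the kernel, which
tends to zero.\<close>

lemma fejer_mean_tendsto:
  fixes f :: "(nat \<Rightarrow> real) \<Rightarrow> complex"
  assumes f: "continuous_on (cube d) f" and x: "x \<in> cube d" "open_cube d x"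
  shows "(\<lambda>n. LINT t|cube_measure d. f t * of_real (fejer d n (\<lambda>i. x i - t i))) \<longlonglongrightarrow> f x"
proof (rule LIMSEQ_I)
  fix e :: real assume "0 < e"
  then have e2: "0 < e / 2"
    by simp
  obtain C where C: "0 \<le> C"
    "\<And>t. t \<in> cube d \<Longrightarrow> norm (f t - f x) \<le> e / 2 + C * (\<Sum>i<d. 1 - cos (2 * pi * (t i - x i)))"
    using korovkin_bound[OF f x e2] by blast
  obtain B where B: "0 < B" "\<And>t. t \<in> cube d \<Longrightarrow> norm (f t) \<le> B"
    using continuous_on_cube_bounded[OF f] by blast
  define w where "w n i = fejer_weight d n (\<lambda>j\<in>{..<d}. of_bool (j = i))" for n i
  define F where "F n t = fejer d n (\<lambda>i. x i - t i)" for n t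
  have bound: "norm ((LINT t|cube_measure d. f t * of_real (F n t)) - f x)
      \<le> e / 2 + C * (\<Sum>i<d. 1 - w n i)" if n: "0 < n" for n
  proof -
    have intF: "integrable (cube_measure d) (F n)"
      and int1: "(LINT t|cube_measure d. F n t) = 1"
      and int_cos: "\<And>i. i < d \<Longrightarrow> integrable (cube_measure d) (\<lambda>t. cos (2 * pi * (t i - x i)) * F n t)"
      and w: "\<And>i. i < d \<Longrightarrow> (LINT t|cube_measure d. cos (2 * pi * (t i - x i)) * F n t) = w n i"
      using fejer_moments n unfolding F_def w_def by auto
    have int_fF: "integrable (cube_measure d) (\<lambda>t. f t * of_real (F n t))"
      unfolding F_def
      using fejer_mean_expansion(1) continuous_on_cube_measurable[OF f] B(2) by blast
    have int_xF: "integrable (cube_measure d) (\<lambda>t. f x * of_real (F n t))"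
      using intF by simp
    have int_diff: "integrable (cube_measure d) (\<lambda>t. (f t - f x) * of_real (F n t))"
      using Bochner_Integration.integrable_diff[OF int_fF int_xF] by (simp add: left_diff_distrib)
    have "(LINT t|cube_measure d. f t * of_real (F n t)) - f x =
        (LINT t|cube_measure d. f t * of_real (F n t)) - (LINT t|cube_measure d. f x * of_real (F n t))"
      using int1 by simp
    also have "\<dots> = (LINT t|cube_measure d. (f t - f x) * of_real (F n t))"
      using Bochner_Integration.integral_diff[OF int_fF int_xF] by (simp add: left_diff_distrib)
    finally have "norm ((LINT t|cube_measure d. f t * of_real (F n t)) - f x) \<le>
        (LINT t|cube_measure d. norm ((f t - f x) * of_real (F n t)))"
      using integral_norm_bound by metis
    also have "\<dots> \<le> (LINT t|cube_measure d.
        e / 2 * F n t + C * (\<Sum>i<d. F n t - cos (2 * pi * (t i - x i)) * F n t))"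
    proof (rule integral_mono)
      show "integrable (cube_measure d) (\<lambda>t. norm ((f t - f x) * of_real (F n t)))"
        using int_diff by (rule integrable_norm)
      show "integrable (cube_measure d)
          (\<lambda>t. e / 2 * F n t + C * (\<Sum>i<d. F n t - cos (2 * pi * (t i - x i)) * F n t))"
        using intF int_cos
        by (intro Bochner_Integration.integrable_add integrable_mult_right
            Bochner_Integration.integrable_sum Bochner_Integration.integrable_diff) auto
      show "norm ((f t - f x) * of_real (F n t)) \<le>
          e / 2 * F n t + C * (\<Sum>i<d. F n t - cos (2 * pi * (t i - x i)) * F n t)"
        if "t \<in> space (cube_measure d)" for t
      proof -
        have nn: "0 \<le> F n t"
          by (simp add: F_def fejer_nonneg)
        have "norm (f t - f x) * F n t \<le>
            (e / 2 + C * (\<Sum>i<d. 1 - cos (2 * pi * (t i - x i)))) * F n t"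
          using C(2)[of t] that nn by (intro mult_right_mono) (auto simp: space_cube_measure)
        also have "\<dots> = e / 2 * F n t + C * ((\<Sum>i<d. 1 - cos (2 * pi * (t i - x i))) * F n t)"
          by (simp only: distrib_right mult.assoc)
        also have "(\<Sum>i<d. 1 - cos (2 * pi * (t i - x i))) * F n t =
            (\<Sum>i<d. F n t - cos (2 * pi * (t i - x i)) * F n t)"
          by (simp only: sum_distrib_right left_diff_distrib mult_1_left)
        finally show ?thesis
          using nn by (simp add: norm_mult)
      qed
    qed
    also have "\<dots> = e / 2 + C * (\<Sum>i<d. 1 - w n i)"
    proof -
      have int_i: "integrable (cube_measure d) (\<lambda>t. F n t - cos (2 * pi * (t i - x i)) * F n t)"
        if "i < d" for i
        using intF int_cos[OF that] by (rule Bochner_Integration.integrable_diff)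
      have "(LINT t|cube_measure d. F n t - cos (2 * pi * (t i - x i)) * F n t) = 1 - w n i"
        if "i < d" for i
        using intF int_cos[OF that] w[OF that] int1 by simp
      then have "(LINT t|cube_measure d. (\<Sum>i<d. F n t - cos (2 * pi * (t i - x i)) * F n t)) =
          (\<Sum>i<d. 1 - w n i)"
        using int_i by (subst Bochner_Integration.integral_sum) auto
      moreover have "integrable (cube_measure d) (\<lambda>t. \<Sum>i<d. F n t - cos (2 * pi * (t i - x i)) * F n t)"
        using int_i by (intro Bochner_Integration.integrable_sum) auto
      ultimately show ?thesis
        using intF int1 by (subst Bochner_Integration.integral_add) simp_all
    qed
    finally show ?thesis .
  qed
  have "(\<lambda>n. C * (\<Sum>i<d. 1 - w n i)) \<longlonglongrightarrow> C * (\<Sum>i<d. 1 - 1)"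
    unfolding w_def by (intro tendsto_intros fejer_weight_tendsto) (simp add: freqs_def)
  then have "(\<lambda>n. C * (\<Sum>i<d. 1 - w n i)) \<longlonglongrightarrow> 0"
    by simp
  then have "\<forall>\<^sub>F n in sequentially. C * (\<Sum>i<d. 1 - w n i) < e / 2"
    using e2 by (rule order_tendstoD)
  then have "\<forall>\<^sub>F n in sequentially. norm ((LINT t|cube_measure d. f t * of_real (F n t)) - f x) < e"
    using eventually_gt_at_top[of 0]
  proof eventually_elim
    case (elim n)
    then show ?case
      using bound[of n] by linarith
  qed
  then show "\<exists>N. \<forall>n\<ge>N. norm ((LINT t|cube_measure d. f t * of_real (fejer d n (\<lambda>i. x i - t i))) - f x) < e"
    by (simp add: eventually_sequentially F_def)
qed

text \<open>The Fejer mean of \<open>f\<close> is a finite sum of Fourier terms with factors in \<open>[0,1]\<close>. Outside \<open>\<Lambda>\<close> it therefore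
obeys the tail bound uniformly in \<open>n\<close>, while on \<open>\<Lambda>\<close> the factors tend to \<open>1\<close>.\<close>

lemma fourier_partial_sum_error:
  fixes f :: "(nat \<Rightarrow> real) \<Rightarrow> complex"
  assumes f: "continuous_on (cube d) f" and x: "x \<in> cube d" "open_cube d x"
    and \<Lambda>: "finite \<Lambda>" "\<Lambda> \<subseteq> freqs d"
    and tail: "\<And>G. finite G \<Longrightarrow> G \<subseteq> freqs d - \<Lambda> \<Longrightarrow> (\<Sum>k\<in>G. norm (fourier_coeff d f k)) \<le> \<eta>"
  shows "norm (f x - (\<Sum>k\<in>\<Lambda>. fourier_coeff d f k * wave d k x)) \<le> \<eta>"
proof -
  define T where "T k = fourier_coeff d f k * wave d k x" for k
  define mean where
    "mean n = (LINT t|cube_measure d. f t * of_real (fejer d n (\<lambda>i. x i - t i)))" for n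
  obtain B where B: "0 < B" "\<And>t. t \<in> cube d \<Longrightarrow> norm (f t) \<le> B"
    using continuous_on_cube_bounded[OF f] by blast
  have close: "norm (mean n - (\<Sum>k\<in>\<Lambda>. of_real (fejer_weight d n k) * T k)) \<le> \<eta>" for n
  proof -
    define D where "D = \<Lambda> \<union> (\<lambda>(j, l). freq_diff d j l) ` (fejer_box d n \<times> fejer_box d n)"
    have D: "finite D" "D \<subseteq> freqs d" "\<Lambda> \<subseteq> D"
      using \<Lambda> freq_diff_in_freqs finite_fejer_box by (auto simp: D_def)
    have "mean n = (\<Sum>(j, l)\<in>fejer_box d n \<times> fejer_box d n. T (freq_diff d j l)) / of_nat n ^ d"
      unfolding mean_def T_def
      using continuous_on_cube_measurable[OF f] B(2) by (rule fejer_mean_expansion(2))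
    also have "\<dots> = (\<Sum>k\<in>D. of_real (fejer_weight d n k) * T k)"
      using D(1) by (rule fejer_mean_regroup) (auto simp: D_def)
    finally have "mean n - (\<Sum>k\<in>\<Lambda>. of_real (fejer_weight d n k) * T k) =
        (\<Sum>k\<in>D - \<Lambda>. of_real (fejer_weight d n k) * T k)"
      using D by (simp add: sum_diff)
    also have "norm \<dots> \<le> (\<Sum>k\<in>D - \<Lambda>. norm (fourier_coeff d f k))"
      using D fejer_weight_bounds[of _ d n]
      by (intro sum_norm_le) (auto simp: T_def norm_mult intro!: mult_left_le_one_le)
    also have "\<dots> \<le> \<eta>"
      using D by (intro tail) auto
    finally show ?thesis .
  qed
  have "(\<lambda>n. \<Sum>k\<in>\<Lambda>. of_real (fejer_weight d n k) * T k) \<longlonglongrightarrow> (\<Sum>k\<in>\<Lambda>. of_real 1 * T k)"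
    using \<Lambda> by (intro tendsto_intros fejer_weight_tendsto) auto
  then have lim: "(\<lambda>n. \<Sum>k\<in>\<Lambda>. of_real (fejer_weight d n k) * T k) \<longlonglongrightarrow> (\<Sum>k\<in>\<Lambda>. T k)"
    by simp
  have "(\<lambda>n. norm (mean n - (\<Sum>k\<in>\<Lambda>. of_real (fejer_weight d n k) * T k)))
      \<longlonglongrightarrow> norm (f x - (\<Sum>k\<in>\<Lambda>. T k))"
    unfolding mean_def by (intro tendsto_norm tendsto_diff fejer_mean_tendsto[OF f x] lim)
  then show ?thesis
    unfolding T_def[symmetric] by (rule LIMSEQ_le_const2) (use close in blast)
qed

section \<open>Recovery on the class\<close>

text \<open>Complex coefficients become nonnegative weights on the four rotations of each term, through the
positive and negative parts of real and imaginary parts. The missing mass is spread evenly, which changes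
nothing because the four rotations add up to zero.\<close>

lemma phase_dictionary:
  fixes a :: "'k \<Rightarrow> complex"
  assumes \<Lambda>: "finite \<Lambda>" "\<Lambda> \<noteq> {}" and a: "(\<Sum>k\<in>\<Lambda>. norm (a k)) \<le> 1 / 2"
  shows "\<exists>w :: 'k \<times> complex \<Rightarrow> real.
    (\<forall>q\<in>\<Lambda> \<times> {1, -1, \<i>, -\<i>}. 0 \<le> w q) \<and> sum w (\<Lambda> \<times> {1, -1, \<i>, -\<i>}) = 1 \<and>
    (\<forall>e. (\<Sum>q\<in>\<Lambda> \<times> {1, -1, \<i>, -\<i>}. of_real (w q) * (snd q * e (fst q))) = (\<Sum>k\<in>\<Lambda>. a k * e k))"
proof -
  let ?U = "{1, -1, \<i>, -\<i>} :: complex set"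
  define w0 where "w0 q = max 0 (Re (cnj (snd q) * a (fst q)))" for q :: "'k \<times> complex"
  define \<rho> where "\<rho> = (1 - sum w0 (\<Lambda> \<times> ?U)) / real (card (\<Lambda> \<times> ?U))"
  define w where "w q = w0 q + \<rho>" for q
  have sum_U: "(\<Sum>c\<in>?U. F c) = F 1 + F (-1) + F \<i> + F (-\<i>)" for F :: "complex \<Rightarrow> 'b::comm_monoid_add"
    by (simp add: complex_eq_iff add.assoc)
  have sum_prod: "(\<Sum>q\<in>\<Lambda> \<times> ?U. F q) = (\<Sum>k\<in>\<Lambda>. \<Sum>c\<in>?U. F (k, c))" for F :: "'k \<times> complex \<Rightarrow> 'b::comm_monoid_add"
    by (simp only: sum.cartesian_product case_prod_eta)
  have "sum w0 (\<Lambda> \<times> ?U) = (\<Sum>k\<in>\<Lambda>. \<bar>Re (a k)\<bar> + \<bar>Im (a k)\<bar>)"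
    unfolding sum_prod sum_U by (intro sum.cong) (auto simp: w0_def max_def)
  also have "\<dots> \<le> (\<Sum>k\<in>\<Lambda>. 2 * norm (a k))"
  proof (rule sum_mono)
    fix k
    show "\<bar>Re (a k)\<bar> + \<bar>Im (a k)\<bar> \<le> 2 * norm (a k)"
      using abs_Re_le_cmod[of "a k"] abs_Im_le_cmod[of "a k"] by linarith
  qed
  also have "\<dots> \<le> 1"
    using a by (simp flip: sum_distrib_left)
  finally have "0 \<le> \<rho>"
    by (simp add: \<rho>_def)
  then have "\<forall>q\<in>\<Lambda> \<times> ?U. 0 \<le> w q"
    by (simp add: w_def w0_def)
  moreover have "sum w (\<Lambda> \<times> ?U) = 1"
  proof -
    have "card (\<Lambda> \<times> ?U) \<noteq> 0"
      using \<Lambda> by auto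
    then have "real (card (\<Lambda> \<times> ?U)) * \<rho> = 1 - sum w0 (\<Lambda> \<times> ?U)"
      by (simp add: \<rho>_def)
    then show ?thesis
      unfolding w_def by (simp only: sum.distrib sum_constant)
  qed
  moreover have "(\<Sum>q\<in>\<Lambda> \<times> ?U. of_real (w q) * (snd q * e (fst q))) = (\<Sum>k\<in>\<Lambda>. a k * e k)" for e
    unfolding sum_prod sum_U
  proof (rule sum.cong)
    fix k
    have "of_real (w (k, 1)) * 1 + of_real (w (k, -1)) * (-1) + of_real (w (k, \<i>)) * \<i> +
        of_real (w (k, -\<i>)) * (-\<i>) = a k"
      by (simp add: w_def w0_def complex_eq_iff max_def)
    then have "a k * e k = (of_real (w (k, 1)) * 1 + of_real (w (k, -1)) * (-1) +
        of_real (w (k, \<i>)) * \<i> + of_real (w (k, -\<i>)) * (-\<i>)) * e k"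
      by (rule arg_cong[OF sym])
    then show "of_real (w (k, 1)) * (snd (k, 1) * e (fst (k, 1))) +
        of_real (w (k, -1)) * (snd (k, -1) * e (fst (k, -1))) +
        of_real (w (k, \<i>)) * (snd (k, \<i>) * e (fst (k, \<i>))) +
        of_real (w (k, -\<i>)) * (snd (k, -\<i>) * e (fst (k, -\<i>))) = a k * e k"
      by (simp only: fst_conv snd_conv distrib_right mult.assoc)
  qed simp
  ultimately show ?thesis
    by blast
qed

definition low_freqs :: "nat \<Rightarrow> nat \<Rightarrow> (nat \<Rightarrow> int) set" where
  "low_freqs d m = {..<d} \<rightarrow>\<^sub>E {- int m..int m}"

lemma low_freqs: "finite (low_freqs d m)" "low_freqs d m \<subseteq> freqs d" "low_freqs d m \<noteq> {}"
  and card_low_freqs: "card (low_freqs d m) = (2 * m + 1) ^ d"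
proof -
  show "finite (low_freqs d m)"
    unfolding low_freqs_def by (intro finite_PiE) auto
  show "low_freqs d m \<subseteq> freqs d"
    unfolding low_freqs_def freqs_def by (intro PiE_mono) auto
  show "low_freqs d m \<noteq> {}"
    unfolding low_freqs_def by (simp add: PiE_eq_empty_iff)
  have "nat (int m + 1 + int m) = 2 * m + 1"
    by simp
  then show "card (low_freqs d m) = (2 * m + 1) ^ d"
    unfolding low_freqs_def by (subst card_PiE) (auto simp: algebra_simps)
qed

lemma log_weight_ge_1: "1 \<le> log_weight d k"
  by (simp add: log_weight_def)

lemma log_weight_high_freq:
  assumes k: "k \<in> freqs d" "k \<notin> low_freqs d m" and m: "exp W \<le> real m"
  shows "W \<le> log_weight d k"
proof -
  obtain i where i: "i < d" "int m < \<bar>k i\<bar>"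
    using k by (auto simp: low_freqs_def freqs_def PiE_iff not_le)
  have "\<bar>k i\<bar> \<le> sup_norm d k"
    unfolding sup_norm_def using i(1) by (intro Max_ge) auto
  then have "real m < real_of_int (sup_norm d k)"
    using i(2) by linarith
  then have "exp W < real_of_int (sup_norm d k)"
    using m by linarith
  moreover have "0 < exp W"
    by simp
  ultimately have "W < ln (real_of_int (sup_norm d k))" "sup_norm d k \<noteq> 0"
    by (auto simp: ln_less_cancel_iff[symmetric] simp del: exp_gt_zero) (metis exp_gt_zero exp_less_cancel_iff exp_ln less_trans)
  then show ?thesis
    by (simp add: log_weight_def)
qed

lemma F_log_finite_sum:
  assumes "f \<in> F_log d" "finite G" "G \<subseteq> freqs d"
  shows "(\<Sum>k\<in>G. norm (fourier_coeff d f k) * log_weight d k) \<le> 1"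
proof -
  have nn: "0 \<le> log_weight d k" for k
    using log_weight_ge_1[of d k] by linarith
  have "(\<Sum>k\<in>G. norm (fourier_coeff d f k) * log_weight d k) \<le>
      (\<Sum>\<^sub>\<infinity>k\<in>freqs d. norm (fourier_coeff d f k) * log_weight d k)"
    using assms nn by (intro finite_sum_le_infsum) (auto simp: F_log_def)
  then show ?thesis
    using assms(1) by (simp add: F_log_def)
qed

lemma fourier_coeff_quarter_diff:
  assumes f: "continuous_on (cube d) f" and g: "continuous_on (cube d) g"
  shows "fourier_coeff d (\<lambda>x. (f x - g x) / 4) k = (fourier_coeff d f k - fourier_coeff d g k) / 4"
proof -
  interpret prob_space "cube_measure d"
    by (rule prob_space_cube_measure)
  have int: "integrable (cube_measure d) (\<lambda>x. h x * wave d (\<lambda>i. - k i) x)"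
    if h: "continuous_on (cube d) h" for h
  proof -
    obtain B where B: "\<And>x. x \<in> cube d \<Longrightarrow> norm (h x) \<le> B"
      using continuous_on_cube_bounded[OF h] by blast
    have [measurable]: "h \<in> borel_measurable (cube_measure d)"
      using h by (rule continuous_on_cube_measurable)
    show ?thesis
    proof (rule integrable_const_bound[where B = B])
      show "AE x in cube_measure d. norm (h x * wave d (\<lambda>i. - k i) x) \<le> B"
        using AE_space[of "cube_measure d"]
        by eventually_elim (simp add: norm_mult space_cube_measure B)
    qed measurable
  qed
  have "fourier_coeff d (\<lambda>x. (f x - g x) / 4) k =
      (LINT x|cube_measure d. (f x * wave d (\<lambda>i. - k i) x - g x * wave d (\<lambda>i. - k i) x) / 4)"
    by (simp add: fourier_coeff_eq left_diff_distrib)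
  also have "\<dots> = (LINT x|cube_measure d. f x * wave d (\<lambda>i. - k i) x - g x * wave d (\<lambda>i. - k i) x) / 4"
    by (rule integral_divide_zero)
  also have "\<dots> = (fourier_coeff d f k - fourier_coeff d g k) / 4"
    using int[OF f] int[OF g] by (simp add: fourier_coeff_eq)
  finally show ?thesis .
qed

lemma Lp_integrable_of_continuous:
  fixes f :: "(nat \<Rightarrow> real) \<Rightarrow> complex"
  assumes f: "continuous_on (cube d) f" and p: "0 < p"
  shows "integrable (cube_measure d) (\<lambda>x. norm (f x) powr p)"
proof -
  interpret prob_space "cube_measure d"
    by (rule prob_space_cube_measure)
  obtain B where B: "\<And>x. x \<in> cube d \<Longrightarrow> norm (f x) \<le> B"
    using continuous_on_cube_bounded[OF f] by blast
  have [measurable]: "f \<in> borel_measurable (cube_measure d)"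
    using f by (rule continuous_on_cube_measurable)
  show ?thesis
  proof (rule integrable_const_bound[where B = "B powr p"])
    show "AE x in cube_measure d. norm (norm (f x) powr p) \<le> B powr p"
      using AE_space[of "cube_measure d"]
      by eventually_elim (use B p in \<open>auto simp: space_cube_measure intro!: powr_mono2\<close>)
  qed measurable
qed

text \<open>An uncomputable recovery map is enough: return any member of the class that matches the data.\<close>

lemma recoverable_of_small_difference:
  assumes cont: "\<And>f. f \<in> F \<Longrightarrow> continuous_on (cube d) f" and p: "0 < p" and \<epsilon>: "0 \<le> \<epsilon>"
    and y: "\<And>l. l < n \<Longrightarrow> y l \<in> cube d"
    and small: "\<And>f g. f \<in> F \<Longrightarrow> g \<in> F \<Longrightarrow> (\<And>l. l < n \<Longrightarrow> f (y l) = g (y l)) \<Longrightarrow>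
      (LINT x|cube_measure d. norm (f x - g x) powr p) \<le> \<epsilon> powr p"
  shows "recoverable \<epsilon> F p d n"
proof -
  define data where "data f = (\<lambda>i\<in>{..<n}. f (y i))" for f :: "(nat \<Rightarrow> real) \<Rightarrow> complex"
  define \<phi> where "\<phi> z = (if \<exists>f\<in>F. data f = z then SOME f. f \<in> F \<and> data f = z else (\<lambda>_. 0))" for z
  have \<phi>: "\<phi> (data f) \<in> F" "data (\<phi> (data f)) = data f" if "f \<in> F" for f
    unfolding \<phi>_def using someI_ex[of "\<lambda>g. g \<in> F \<and> data g = data f"] that by auto
  have "\<phi> z \<in> Lp_space p d" for z
  proof (cases "\<exists>f\<in>F. data f = z")
    case True
    then have "\<phi> z \<in> F"
      using \<phi>(1) by auto
    then show ?thesis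
      using cont Lp_integrable_of_continuous p continuous_on_cube_measurable
      by (simp add: Lp_space_def)
  qed (use p in \<open>simp add: \<phi>_def Lp_space_def\<close>)
  moreover have "Lp_norm p d (\<lambda>t. f t - \<phi> (data f) t) \<le> \<epsilon>" if f: "f \<in> F" for f
  proof -
    have "f (y l) = \<phi> (data f) (y l)" if "l < n" for l
      using fun_cong[OF \<phi>(2)[OF f], of l] that by (simp add: data_def)
    then have "(LINT x|cube_measure d. norm (f x - \<phi> (data f) x) powr p) \<le> \<epsilon> powr p"
      using small[OF f \<phi>(1)[OF f]] by blast
    then have "Lp_norm p d (\<lambda>t. f t - \<phi> (data f) t) \<le> (\<epsilon> powr p) powr (1 / p)"
      unfolding Lp_norm_def using p by (intro powr_mono2) auto
    then show ?thesis
      using p \<epsilon> by (simp add: powr_powr)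
  qed
  ultimately show ?thesis
    unfolding recoverable_def using y by (intro exI[of _ y] exI[of _ \<phi>]) (auto simp: data_def)
qed

text \<open>The difference of two members of the class is divided by \<open>4\<close>: its Fourier coefficients then have
weighted absolute sum at most \<open>1/2\<close>, as the phase dictionary requires, and the precision becomes \<open>\<epsilon> / 4\<close>.
A weight of at least \<open>64 / \<epsilon>\<close> on the high frequencies makes their contribution at most
\<open>\<epsilon> / 128 = (\<epsilon> / 4) / 32\<close>.\<close>

lemma recoverable_F_log:
  fixes p \<epsilon> :: real
  assumes p: "2 \<le> p" and \<epsilon>: "0 < \<epsilon>" "\<epsilon> < 1 / 2"
    and m: "exp (64 / \<epsilon>) \<le> real m"
    and J: "1 / 2 ^ J \<le> \<epsilon> / 4 / 2" "\<epsilon> / 4 / 4 \<le> 1 / 2 ^ J"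
    and s: "\<And>j. j \<le> J \<Longrightarrow> Suc j \<le> s j"
      "\<And>j. j \<le> J \<Longrightarrow> 8 * exp (- (real (s j) * (1 / 2 ^ j / 4)\<^sup>2 / 64)) \<le> level_mass p (\<epsilon> / 4) J j / 8"
    and n: "\<And>j. j \<le> J \<Longrightarrow> 2 * real (s j) * ln (real (4 * (2 * m + 1) ^ d)) \<le> real n * level_mass p (\<epsilon> / 4) J j / 8"
  shows "recoverable \<epsilon> (F_log d) p d n"
proof -
  interpret prob_space "cube_measure d"
    by (rule prob_space_cube_measure)
  define \<Lambda> where "\<Lambda> = low_freqs d m"
  define U where "U = ({1, -1, \<i>, -\<i>} :: complex set)"
  define v where "v q x = snd q * wave d (fst q) x" for q x
  have \<Lambda>: "finite \<Lambda>" "\<Lambda> \<subseteq> freqs d" "\<Lambda> \<noteq> {}"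
    unfolding \<Lambda>_def by (rule low_freqs)+
  have card_U: "card U = 4"
    by (simp add: U_def complex_eq_iff card_insert_if)
  then have card: "card (\<Lambda> \<times> U) = 4 * (2 * m + 1) ^ d"
    by (simp add: card_cartesian_product \<Lambda>_def card_low_freqs)
  have "\<exists>y. (\<forall>l<n. y l \<in> space (cube_measure d) \<and> open_cube d (y l)) \<and>
    (\<forall>h w. h \<in> borel_measurable (cube_measure d) \<longrightarrow> (\<forall>q\<in>\<Lambda> \<times> U. 0 \<le> w q) \<longrightarrow> sum w (\<Lambda> \<times> U) = 1 \<longrightarrow>
       (\<forall>x\<in>space (cube_measure d). open_cube d x \<longrightarrow>
          norm (h x - (\<Sum>q\<in>\<Lambda> \<times> U. of_real (w q) * v q x)) \<le> \<epsilon> / 4 / 32) \<longrightarrow>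
       (\<forall>l<n. h (y l) = 0) \<longrightarrow> expectation (\<lambda>x. norm (h x) powr p) \<le> (\<epsilon> / 4) powr p)"
  proof (rule exists_norming_points[where J = J and s = s])
    show "finite (\<Lambda> \<times> U)"
      using \<Lambda> by (simp add: U_def)
    have "1 \<le> (2 * m + 1) ^ d"
      by simp
    then show "2 \<le> card (\<Lambda> \<times> U)"
      unfolding card by linarith
    show "v q \<in> borel_measurable (cube_measure d)" for q
      unfolding v_def by measurable
    show "norm (v q x) \<le> 1" if "q \<in> \<Lambda> \<times> U" for q x
      using that by (auto simp: v_def U_def norm_mult)
    show "2 * real (s j) * ln (real (card (\<Lambda> \<times> U))) \<le> real n * level_mass p (\<epsilon> / 4) J j / 8"
      if "j \<le> J" for j
      unfolding card using n[OF that] .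
    show "AE x in cube_measure d. open_cube d x"
      by (rule AE_open_cube)
    show "1 \<le> p" "0 < \<epsilon> / 4" "\<epsilon> / 4 \<le> 1"
      using p \<epsilon> by simp_all
  qed (fact J s)+
  then obtain y where y: "\<forall>l<n. y l \<in> cube d \<and> open_cube d (y l)"
    and norming: "\<forall>h w. h \<in> borel_measurable (cube_measure d) \<longrightarrow> (\<forall>q\<in>\<Lambda> \<times> U. 0 \<le> w q) \<longrightarrow>
       sum w (\<Lambda> \<times> U) = 1 \<longrightarrow>
       (\<forall>x\<in>cube d. open_cube d x \<longrightarrow>
          norm (h x - (\<Sum>q\<in>\<Lambda> \<times> U. of_real (w q) * v q x)) \<le> \<epsilon> / 4 / 32) \<longrightarrow>
       (\<forall>l<n. h (y l) = 0) \<longrightarrow> expectation (\<lambda>x. norm (h x) powr p) \<le> (\<epsilon> / 4) powr p"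
    unfolding space_cube_measure by (elim exE conjE)
  show ?thesis
  proof (rule recoverable_of_small_difference)
    fix f g
    assume f: "f \<in> F_log d" and g: "g \<in> F_log d" and agree: "\<And>l. l < n \<Longrightarrow> f (y l) = g (y l)"
    have cont: "continuous_on (cube d) f" "continuous_on (cube d) g"
      using f g by (auto simp: F_log_def)
    define h where "h x = (f x - g x) / 4" for x
    have h_cont: "continuous_on (cube d) h"
      unfolding h_def using cont by (intro continuous_intros) auto
    have weighted: "(\<Sum>k\<in>G. norm (fourier_coeff d h k) * log_weight d k) \<le> 1 / 2"
      if "finite G" "G \<subseteq> freqs d" for G
    proof -
      have "norm (fourier_coeff d h k) * log_weight d k \<le>
          (norm (fourier_coeff d f k) * log_weight d k + norm (fourier_coeff d g k) * log_weight d k) / 4" for k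
      proof -
        have "norm (fourier_coeff d h k) \<le> (norm (fourier_coeff d f k) + norm (fourier_coeff d g k)) / 4"
          unfolding h_def fourier_coeff_quarter_diff[OF cont] by (simp add: norm_divide norm_triangle_ineq4)
        then have "norm (fourier_coeff d h k) * log_weight d k \<le>
            (norm (fourier_coeff d f k) + norm (fourier_coeff d g k)) / 4 * log_weight d k"
          using log_weight_ge_1[of d k] by (intro mult_right_mono) auto
        then show ?thesis
          by (simp add: algebra_simps add_divide_distrib)
      qed
      then have "(\<Sum>k\<in>G. norm (fourier_coeff d h k) * log_weight d k) \<le>
          (\<Sum>k\<in>G. (norm (fourier_coeff d f k) * log_weight d k + norm (fourier_coeff d g k) * log_weight d k) / 4)"
        by (rule sum_mono)
      also have "\<dots> = ((\<Sum>k\<in>G. norm (fourier_coeff d f k) * log_weight d k) +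
          (\<Sum>k\<in>G. norm (fourier_coeff d g k) * log_weight d k)) / 4"
        by (simp only: sum.distrib flip: sum_divide_distrib)
      also have "\<dots> \<le> (1 + 1) / 4"
        using F_log_finite_sum[OF f that] F_log_finite_sum[OF g that] by simp
      finally show ?thesis
        by simp
    qed
    have "(\<Sum>k\<in>\<Lambda>. norm (fourier_coeff d h k)) \<le> (\<Sum>k\<in>\<Lambda>. norm (fourier_coeff d h k) * log_weight d k)"
      using log_weight_ge_1 by (intro sum_mono) (simp add: mult_le_cancel_left1)
    also have "\<dots> \<le> 1 / 2"
      using \<Lambda> by (intro weighted)
    finally obtain w where w: "\<forall>q\<in>\<Lambda> \<times> U. 0 \<le> w q" "sum w (\<Lambda> \<times> U) = 1"
      "\<And>e. (\<Sum>q\<in>\<Lambda> \<times> U. of_real (w q) * (snd q * e (fst q))) = (\<Sum>k\<in>\<Lambda>. fourier_coeff d h k * e k)"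
      using phase_dictionary[OF \<Lambda>(1,3), of "fourier_coeff d h"] unfolding U_def by blast
    have tail: "(\<Sum>k\<in>G. norm (fourier_coeff d h k)) \<le> \<epsilon> / 4 / 32" if G: "finite G" "G \<subseteq> freqs d - \<Lambda>" for G
    proof -
      have "(\<Sum>k\<in>G. norm (fourier_coeff d h k) * (64 / \<epsilon>)) \<le>
          (\<Sum>k\<in>G. norm (fourier_coeff d h k) * log_weight d k)"
        using G m by (intro sum_mono mult_left_mono log_weight_high_freq) (auto simp: \<Lambda>_def)
      also have "\<dots> \<le> 1 / 2"
        using G by (intro weighted) auto
      finally have "(\<Sum>k\<in>G. norm (fourier_coeff d h k)) * (64 / \<epsilon>) \<le> 1 / 2"
        by (simp only: sum_distrib_right)
      then show ?thesis
        using \<epsilon> by (simp add: field_simps)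
    qed
    have "expectation (\<lambda>x. norm (h x) powr p) \<le> (\<epsilon> / 4) powr p"
    proof (rule norming[rule_format, OF continuous_on_cube_measurable[OF h_cont] _ w(2)])
      show "0 \<le> w q" if "q \<in> \<Lambda> \<times> U" for q
        using w(1) that by blast
      show "norm (h x - (\<Sum>q\<in>\<Lambda> \<times> U. of_real (w q) * v q x)) \<le> \<epsilon> / 4 / 32"
        if "x \<in> cube d" "open_cube d x" for x
        using fourier_partial_sum_error[OF h_cont that \<Lambda>(1,2) tail] w(3)[of "\<lambda>k. wave d k x"]
        by (simp add: v_def)
    qed (simp add: h_def agree)
    then have "4 powr p * expectation (\<lambda>x. norm (h x) powr p) \<le> 4 powr p * (\<epsilon> / 4) powr p"
      by (rule mult_left_mono) simp
    moreover have "norm (f x - g x) powr p = 4 powr p * norm (h x) powr p" for x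
      by (simp add: h_def norm_divide flip: powr_mult)
    then have "(LINT x|cube_measure d. norm (f x - g x) powr p) = 4 powr p * expectation (\<lambda>x. norm (h x) powr p)"
      by (simp only: integral_mult_right_zero)
    moreover have "4 powr p * (\<epsilon> / 4) powr p = \<epsilon> powr p"
      using \<epsilon> by (simp flip: powr_mult)
    ultimately show "(LINT x|cube_measure d. norm (f x - g x) powr p) \<le> \<epsilon> powr p"
      by linarith
  next
    show "continuous_on (cube d) f" if "f \<in> F_log d" for f
      using that by (simp add: F_log_def)
    show "0 < p" "0 \<le> \<epsilon>"
      using p \<epsilon> by simp_all
    show "y l \<in> cube d" if "l < n" for l
      using y that by blast
  qed
qed

text \<open>The logarithm of the size of the dictionary is of order \<open>d / \<epsilon>\<close>, since the frequencies extend up to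
\<open>exp (64 / \<epsilon>)\<close>. The resulting power \<open>\<epsilon> powr (- p - 1)\<close> is at most the claimed one because \<open>p \<ge> 2\<close>, and the
square of the logarithm is, up to a constant, at most the cube of \<open>ln (\<epsilon> powr (- p)) \<ge> 1\<close>.\<close>

lemma sample_count_bound:
  fixes p C :: real
  assumes p: "2 \<le> p" and C: "0 < C" and \<epsilon>: "0 < \<epsilon>" "\<epsilon> < 1 / 2" and d: "1 \<le> d"
  shows "C * (ln (1 / (\<epsilon> / 4)))\<^sup>2 * (\<epsilon> / 4) powr (- p) * ln (real (4 * (2 * nat \<lceil>exp (64 / \<epsilon>)\<rceil> + 1) ^ d)) + 1
    \<le> (C * 612 * 4 powr p + 1) * real d * \<epsilon> powr (- 3 * p / 2) * (ln (\<epsilon> powr (- p))) ^ 3"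
proof -
  define l where "l = ln (1 / \<epsilon>)"
  define X where "X = ln (\<epsilon> powr (- p))"
  define m where "m = nat \<lceil>exp (64 / \<epsilon>)\<rceil>"
  have ln2: "1 / 2 \<le> ln (2 :: real)"
    using ln2_ge_two_thirds by linarith
  have "ln 2 \<le> ln (1 / \<epsilon>)"
    using \<epsilon> by (subst ln_le_cancel_iff) (auto simp: field_simps)
  then have l: "ln 2 \<le> l" "1 / 2 \<le> l"
    using ln2 by (auto simp: l_def)
  have X_eq: "X = p * l"
    using \<epsilon> by (simp add: X_def l_def ln_powr ln_div)
  have X: "1 \<le> X" "l \<le> X"
    unfolding X_eq using mult_mono[of 2 p "1/2" l] mult_right_mono[of 1 p l] p l by auto
  have inv: "2 \<le> 1 / \<epsilon>"
    using \<epsilon> by (simp add: field_simps)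
  have "ln (4 :: real) = 2 * ln 2"
    using ln_realpow[of 2 2] by simp
  moreover have "ln (1 / (\<epsilon> / 4)) = ln 4 + l"
    using \<epsilon> by (simp add: l_def ln_div)
  ultimately have L: "0 \<le> ln (1 / (\<epsilon> / 4))" "ln (1 / (\<epsilon> / 4)) \<le> 3 * l"
    using l by auto
  have "(ln (1 / (\<epsilon> / 4)))\<^sup>2 \<le> (3 * l)\<^sup>2"
    using L by (intro power_mono)
  also have "\<dots> = 9 * l ^ 2"
    by (simp add: power_mult_distrib)
  also have "\<dots> \<le> 9 * X ^ 2"
    using X l by (intro mult_left_mono power_mono) auto
  also have "\<dots> \<le> 9 * X ^ 3"
    using X by (intro mult_left_mono power_increasing) auto
  finally have log_sq: "(ln (1 / (\<epsilon> / 4)))\<^sup>2 \<le> 9 * X ^ 3" .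
  have eps_p: "(\<epsilon> / 4) powr (- p) = 4 powr p * \<epsilon> powr (- p)"
    using \<epsilon> powr_divide[of \<epsilon> 4 "- p"] powr_minus_divide[of 4 p] by simp
  have card_log: "ln (real (4 * (2 * m + 1) ^ d)) \<le> 68 * real d / \<epsilon>"
  proof -
    have one_le: "1 \<le> exp (64 / \<epsilon>)"
      using \<epsilon> by simp
    moreover have "real m \<le> exp (64 / \<epsilon>) + 1"
      unfolding m_def using one_le by linarith
    moreover have "real (2 * m + 1) = 2 * real m + 1"
      by simp
    ultimately have "real (2 * m + 1) \<le> 5 * exp (64 / \<epsilon>)"
      by linarith
    then have "ln (real (2 * m + 1)) \<le> ln (5 * exp (64 / \<epsilon>))"
      by (subst ln_le_cancel_iff) auto
    also have "\<dots> = ln 5 + 64 / \<epsilon>"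
      by (simp add: ln_mult)
    also have "ln (5 :: real) \<le> 4"
      using ln_le_minus_one[of "5 :: real"] by simp
    finally have "ln (real (2 * m + 1)) \<le> 66 * (1 / \<epsilon>)"
      using inv by simp
    then have "real d * ln (real (2 * m + 1)) \<le> real d * (66 * (1 / \<epsilon>))"
      by (rule mult_left_mono) simp
    then have "real d * ln (real (2 * m + 1)) \<le> 66 * (real d * (1 / \<epsilon>))"
      by (simp only: mult.left_commute[of "real d" 66])
    moreover have "ln (4 :: real) \<le> 3"
      using ln_le_minus_one[of "4 :: real"] by simp
    moreover have "1 * 2 \<le> real d * (1 / \<epsilon>)"
      using inv d by (intro mult_mono) auto
    moreover have "68 * real d / \<epsilon> = 68 * (real d * (1 / \<epsilon>))"
      by simp
    moreover have "ln (real (4 * (2 * m + 1) ^ d)) = ln 4 + real d * ln (real (2 * m + 1))"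
    proof -
      have pos: "0 < real (2 * m + 1)"
        by simp
      have "real (4 * (2 * m + 1) ^ d) = 4 * real (2 * m + 1) ^ d"
        by (simp only: of_nat_mult of_nat_power of_nat_numeral)
      also have "ln \<dots> = ln 4 + ln (real (2 * m + 1) ^ d)"
        using zero_less_power[OF pos, of d] by (intro ln_mult_pos) simp_all
      also have "ln (real (2 * m + 1) ^ d) = real d * ln (real (2 * m + 1))"
        by (rule ln_realpow)
      finally show ?thesis .
    qed
    ultimately show ?thesis
      by linarith
  qed
  have ln_nonneg: "0 \<le> ln (real (4 * (2 * m + 1) ^ d))"
  proof (rule ln_ge_zero)
    have "1 \<le> 4 * (2 * m + 1) ^ d"
      by (simp add: Suc_le_eq)
    then show "1 \<le> real (4 * (2 * m + 1) ^ d)"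
      by (metis of_nat_1 of_nat_le_iff)
  qed
  define R where "R = real d * \<epsilon> powr (- 3 * p / 2) * X ^ 3"
  have exponent: "\<epsilon> powr (- p) * (1 / \<epsilon>) \<le> \<epsilon> powr (- 3 * p / 2)"
  proof -
    have "\<epsilon> powr (- p) * (1 / \<epsilon>) = \<epsilon> powr (- p - 1)"
      using \<epsilon> by (simp add: powr_diff)
    also have "\<dots> \<le> \<epsilon> powr (- 3 * p / 2)"
      using \<epsilon> p by (intro powr_mono') auto
    finally show ?thesis .
  qed
  have "C * (ln (1 / (\<epsilon> / 4)))\<^sup>2 * (\<epsilon> / 4) powr (- p) * ln (real (4 * (2 * m + 1) ^ d))
      \<le> C * (9 * X ^ 3) * (4 powr p * \<epsilon> powr (- p)) * (68 * real d / \<epsilon>)"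
    unfolding eps_p using log_sq card_log ln_nonneg C X
    by (intro mult_mono[OF mult_right_mono[OF mult_left_mono]]) auto
  also have "\<dots> = C * 612 * 4 powr p * (real d * (\<epsilon> powr (- p) * (1 / \<epsilon>)) * X ^ 3)"
    by simp
  also have "\<dots> \<le> C * 612 * 4 powr p * R"
    unfolding R_def using exponent C X
    by (intro mult_left_mono mult_right_mono) auto
  finally have main: "C * (ln (1 / (\<epsilon> / 4)))\<^sup>2 * (\<epsilon> / 4) powr (- p) * ln (real (4 * (2 * m + 1) ^ d))
      \<le> C * 612 * 4 powr p * R" .
  have "1 \<le> \<epsilon> powr (- 3 * p / 2)"
    using powr_mono'[of "- 3 * p / 2" 0 \<epsilon>] \<epsilon> p by simp
  then have "1 * 1 * 1 \<le> R"
    unfolding R_def using d X by (intro mult_mono one_le_power) auto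
  with main show ?thesis
    unfolding m_def X_def[symmetric] by (simp add: R_def algebra_simps)
qed

theorem corollary13:
  fixes p :: real
  assumes "2 \<le> p"
  shows "\<exists>c::real. c > 0 \<and> (\<forall>(d::nat) (\<epsilon>::real). 2 \<le> d \<longrightarrow> 0 < \<epsilon> \<longrightarrow> \<epsilon> < 1 / 2 \<longrightarrow>
    ereal_of_enat (complexity \<epsilon> (F_log d) p d)
      \<le> ereal (c * real d * \<epsilon> powr (- 3 * p / 2) * (ln (\<epsilon> powr (- p))) ^ 3))"
proof -
  obtain C where C: "0 < C" and params: "\<And>\<epsilon>. 0 < \<epsilon> \<Longrightarrow> \<epsilon> < 1 / 2 \<Longrightarrow>
    (\<exists>J s. 1 / 2 ^ J \<le> \<epsilon> / 2 \<and> \<epsilon> / 4 \<le> 1 / 2 ^ J \<and>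
    (\<forall>j\<le>J. Suc j \<le> s j \<and>
       8 * exp (- (real (s j) * (1 / 2 ^ j / 4)\<^sup>2 / 64)) \<le> level_mass p \<epsilon> J j / 8 \<and>
       2 * real (s j) \<le> C * (ln (1 / \<epsilon>))\<^sup>2 * \<epsilon> powr (- p) * level_mass p \<epsilon> J j / 8))"
    using level_parameters[OF assms] by blast
  have "ereal_of_enat (complexity \<epsilon> (F_log d) p d)
      \<le> ereal ((C * 612 * 4 powr p + 1) * real d * \<epsilon> powr (- 3 * p / 2) * (ln (\<epsilon> powr (- p))) ^ 3)"
    if d: "2 \<le> d" and \<epsilon>: "0 < \<epsilon>" "\<epsilon> < 1 / 2" for d :: nat and \<epsilon> :: real
  proof -
    obtain J s where J: "1 / 2 ^ J \<le> \<epsilon> / 4 / 2" "\<epsilon> / 4 / 4 \<le> 1 / 2 ^ J"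
      and s: "\<And>j. j \<le> J \<Longrightarrow> Suc j \<le> s j"
        "\<And>j. j \<le> J \<Longrightarrow> 8 * exp (- (real (s j) * (1 / 2 ^ j / 4)\<^sup>2 / 64)) \<le> level_mass p (\<epsilon> / 4) J j / 8"
        "\<And>j. j \<le> J \<Longrightarrow> 2 * real (s j) \<le>
           C * (ln (1 / (\<epsilon> / 4)))\<^sup>2 * (\<epsilon> / 4) powr (- p) * level_mass p (\<epsilon> / 4) J j / 8"
      using params[of "\<epsilon> / 4"] \<epsilon> by auto
    define m where "m = nat \<lceil>exp (64 / \<epsilon>)\<rceil>"
    define N where "N = ln (real (4 * (2 * m + 1) ^ d))"
    define K where "K = C * (ln (1 / (\<epsilon> / 4)))\<^sup>2 * (\<epsilon> / 4) powr (- p) * N"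
    define n where "n = nat \<lceil>K\<rceil>"
    have "1 \<le> 4 * (2 * m + 1) ^ d"
      by (simp add: Suc_le_eq)
    then have "1 \<le> real (4 * (2 * m + 1) ^ d)"
      by (metis of_nat_1 of_nat_le_iff)
    then have N: "0 \<le> N"
      unfolding N_def by (rule ln_ge_zero)
    have "0 \<le> K"
      unfolding K_def using N C by simp
    then have n: "K \<le> real n" "real n \<le> K + 1"
      unfolding n_def by linarith+
    have "recoverable \<epsilon> (F_log d) p d n"
    proof (rule recoverable_F_log[OF assms \<epsilon> _ J s(1,2), where m = m])
      show "exp (64 / \<epsilon>) \<le> real m"
        unfolding m_def by linarith
      fix j assume j: "j \<le> J"
      have "2 * real (s j) * N \<le> (C * (ln (1 / (\<epsilon> / 4)))\<^sup>2 * (\<epsilon> / 4) powr (- p) * level_mass p (\<epsilon> / 4) J j / 8) * N"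
        using s(3)[OF j] N by (rule mult_right_mono)
      also have "\<dots> = K * (level_mass p (\<epsilon> / 4) J j / 8)"
        by (simp add: K_def)
      also have "\<dots> \<le> real n * (level_mass p (\<epsilon> / 4) J j / 8)"
        using n(1) by (intro mult_right_mono) (auto simp: level_mass_def)
      finally show "2 * real (s j) * ln (real (4 * (2 * m + 1) ^ d)) \<le> real n * level_mass p (\<epsilon> / 4) J j / 8"
        by (simp add: N_def)
    qed
    then have "complexity \<epsilon> (F_log d) p d \<le> enat n"
      unfolding complexity_def by (intro Inf_lower) auto
    then have "ereal_of_enat (complexity \<epsilon> (F_log d) p d) \<le> ereal (real n)"
      by (metis ereal_of_enat_le_iff ereal_of_enat_simps(1))
    also have "real n \<le> (C * 612 * 4 powr p + 1) * real d * \<epsilon> powr (- 3 * p / 2) * (ln (\<epsilon> powr (- p))) ^ 3"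
      using n(2) sample_count_bound[OF assms C \<epsilon>, of d] d unfolding K_def N_def m_def by simp
    finally show ?thesis
      by simp
  qed
  moreover have "0 < C * 612 * 4 powr p + 1"
    using C by (simp add: add_pos_pos)
  ultimately show ?thesis
    by blast
qed

end
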